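(* Let $\Omega_j\subset\mathbb{C}^{n_j}$, $j=1,2$, be bounded convex domains with $\mathcal{C}^1$-smooth boundaries. Suppose that there exist a constant $r>0$, a function $\omega:[0,2r)\to[0,\infty)$ and, for each $j=1,2$, a defining function $\rho_j$ for $\Omega_j$ such that for each $\xi\in\partial\Omega_j$ the directional derivative $D_{i\eta^{\xi}}\rho_j$ has modulus of continuity $\omega$ on the ball $B^{(n_j)}(\xi,r)$ (with the same $r$ and $\omega$ for $j=1,2$ and all $\xi$). Assume that $\omega$ satisfies a Dini condition. If $\Omega_2$ is $\mathbb{C}$-strictly convex, then every isometric embedding $F:\Omega_1\to\Omega_2$ with respect to the Kobayashi distances (that is, every map with $\mathsf{k}_{\Omega_2}(F(z),F(w))=\mathsf{k}_{\Omega_1}(z,w)$ for all $z,w\in\Omega_1$) extends to a continuous map $\widetilde F:\overline{\Omega}_1\to\overline{\Omega}_2$.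
   Context: Notation: $\mathbb{C}^n$ is identified with $\mathbb{R}^{2n}$ in the usual way; $B^{(n)}(a,r)$ is the open Euclidean ball in $\mathbb{C}^n$ with centre $a$ and radius $r$; $\mathsf{k}_\Omega$ is the Kobayashi distance on $\Omega$. Boundary data: a defining function for a bounded domain $\Omega$ with $\mathcal{C}^1$ boundary is a real-valued $\mathcal{C}^1$ function $\rho$ on a neighbourhood $U$ of $\partial\Omega$ with $\Omega\cap U=\{\rho<0\}$, $\partial\Omega=\{\rho=0\}$, and $D\rho\neq 0$ on $\partial\Omega$; $U$ is understood to contain the balls $B^{(n)}(\xi,r)$, $\xi\in\partial\Omega$, occurring in the statement. For $\xi\in\partial\Omega$, $\eta^\xi$ is the unit inward-pointing normal to $\partial\Omega$ at $\xi$, regarded as a vector in $\mathbb{C}^n$, and $i\eta^\xi$ is its product with $i$ (again a real unit vector in $\mathbb{R}^{2n}$). For a unit vector $v$, $D_v\rho$ is the real directional derivative of $\rho$ in the direction $v$. Modulus of continuity: a function $f$ on a ball $B^{(n)}(\xi,r)$ has modulus of continuity $\omega:[0,2r)\to[0,\infty)$ if $\omega$ is non-decreasing, $\omega(0)=0$, $\omega$ is continuous at $0$, and $|f(x)-f(y)|\le\omega(\|x-y\|)$ for all $x,y$ in the ball. Dini condition: a Lebesgue-measurable $g:[0,\epsilon_0)\to[0,\infty)$, $\epsilon_0>0$, satisfies a Dini condition if $\int_0^{\epsilon_0}\frac{g(t)}{t}\,dt<\infty$. $\mathbb{C}$-strict convexity: a convex domain $\Omega\subset\mathbb{C}^n$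 with $\mathcal{C}^1$ boundary is $\mathbb{C}$-strictly convex if $(\xi+T^{\mathbb{C}}_\xi(\partial\Omega))\cap\overline\Omega=\{\xi\}$ for every $\xi\in\partial\Omega$, where $T_\xi(\partial\Omega)$ is the real tangent space viewed as a real hyperplane (linear subspace) of $\mathbb{R}^{2n}\equiv\mathbb{C}^n$ and $T^{\mathbb{C}}_\xi(\partial\Omega)=T_\xi(\partial\Omega)\cap iT_\xi(\partial\Omega)$. *)

theory Defs
  imports "HOL-Analysis.Analysis"
begin

text \<open>
  The space \<open>complex ^ 'n\<close> models $\mathbb{C}^n$. Its \<open>norm\<close>, \<open>inner\<close> and \<open>*\<^sub>R\<close> are those of
  $\mathbb{R}^{2n}$, and \<open>c *s v\<close> is multiplication by a complex scalar.
\<close>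

subsection \<open>Kobayashi distance\<close>

text \<open>Normalised as the distance of the metric $|dz| / (1 - |z|^2)$.\<close>

definition poincare_dist :: "complex \<Rightarrow> complex \<Rightarrow> real" where
  "poincare_dist a b = artanh (norm ((a - b) / (1 - cnj b * a)))"

definition holomorphic_disc :: "(complex \<Rightarrow> complex ^ 'n) \<Rightarrow> (complex ^ 'n) set \<Rightarrow> bool" where
  "holomorphic_disc f \<Omega> \<longleftrightarrow>
     (\<forall>k. (\<lambda>\<zeta>. f \<zeta> $ k) holomorphic_on ball 0 1) \<and> f ` ball 0 1 \<subseteq> \<Omega>"

text \<open>
  A chain of \<open>m\<close> holomorphic discs \<open>f j\<close> in \<open>\<Omega>\<close> joining \<open>z = p 0\<close> to \<open>w = p m\<close>, the \<open>j\<close>-th disc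
  sending \<open>a j\<close> to \<open>p j\<close> and \<open>b j\<close> to \<open>p (j + 1)\<close>.
\<close>

definition disc_chain ::
  "(complex ^ 'n) set \<Rightarrow> complex ^ 'n \<Rightarrow> complex ^ 'n \<Rightarrow> nat \<Rightarrow> (nat \<Rightarrow> complex ^ 'n) \<Rightarrow>
   (nat \<Rightarrow> complex \<Rightarrow> complex ^ 'n) \<Rightarrow> (nat \<Rightarrow> complex) \<Rightarrow> (nat \<Rightarrow> complex) \<Rightarrow> bool" where
  "disc_chain \<Omega> z w m p f a b \<longleftrightarrow>
     0 < m \<and> p 0 = z \<and> p m = w \<and>
     (\<forall>j<m. holomorphic_disc (f j) \<Omega> \<and> a j \<in> ball 0 1 \<and> b j \<in> ball 0 1 \<and>
            f j (a j) = p j \<and> f j (b j) = p (Suc j))"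

definition kobayashi_dist :: "(complex ^ 'n) set \<Rightarrow> complex ^ 'n \<Rightarrow> complex ^ 'n \<Rightarrow> real" where
  "kobayashi_dist \<Omega> z w =
     Inf {(\<Sum>j<m. poincare_dist (a j) (b j)) | m p f a b. disc_chain \<Omega> z w m p f a b}"

definition kobayashi_isometric_embedding ::
  "(complex ^ 'm \<Rightarrow> complex ^ 'n) \<Rightarrow> (complex ^ 'm) set \<Rightarrow> (complex ^ 'n) set \<Rightarrow> bool" where
  "kobayashi_isometric_embedding F \<Omega>\<^sub>1 \<Omega>\<^sub>2 \<longleftrightarrow>
     F ` \<Omega>\<^sub>1 \<subseteq> \<Omega>\<^sub>2 \<and>
     (\<forall>z\<in>\<Omega>\<^sub>1. \<forall>w\<in>\<Omega>\<^sub>1. kobayashi_dist \<Omega>\<^sub>2 (F z) (F w) = kobayashi_dist \<Omega>\<^sub>1 z w)"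

subsection \<open>Defining functions, tangent spaces and normals\<close>

definition C1_on :: "('a::euclidean_space \<Rightarrow> real) \<Rightarrow> 'a set \<Rightarrow> bool" where
  "C1_on \<rho> U \<longleftrightarrow>
     (\<exists>\<rho>' :: 'a \<Rightarrow> 'a \<Rightarrow>\<^sub>L real.
        (\<forall>x\<in>U. (\<rho> has_derivative blinfun_apply (\<rho>' x)) (at x)) \<and> continuous_on U \<rho>')"

text \<open>Only the values of \<open>\<rho>\<close> on the neighbourhood \<open>U\<close> of the boundary are meaningful.\<close>

definition defining_function ::
  "'a::euclidean_space set \<Rightarrow> 'a set \<Rightarrow> ('a \<Rightarrow> real) \<Rightarrow> bool" where
  "defining_function \<Omega> U \<rho> \<longleftrightarrow>
     open U \<and> frontier \<Omega> \<subseteq> U \<and> C1_on \<rho> U \<and>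
     \<Omega> \<inter> U = {x\<in>U. \<rho> x < 0} \<and> frontier \<Omega> = {x\<in>U. \<rho> x = 0} \<and>
     (\<forall>\<xi>\<in>frontier \<Omega>. frechet_derivative \<rho> (at \<xi>) \<noteq> (\<lambda>v. 0))"

definition C1_boundary :: "'a::euclidean_space set \<Rightarrow> bool" where
  "C1_boundary \<Omega> \<longleftrightarrow> (\<exists>U \<rho>. defining_function \<Omega> U \<rho>)"

text \<open>
  The kernel of the differential of a defining function; it does not depend on the defining
  function chosen, see \<open>real_tangent_space_eq\<close> below.
\<close>

definition real_tangent_space :: "'a::euclidean_space set \<Rightarrow> 'a \<Rightarrow> 'a set" where
  "real_tangent_space \<Omega> \<xi> =
     {v. \<exists>U \<rho>. defining_function \<Omega> U \<rho> \<and> frechet_derivative \<rho> (at \<xi>) v = 0}"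

definition complex_tangent_space ::
  "(complex ^ 'n) set \<Rightarrow> complex ^ 'n \<Rightarrow> (complex ^ 'n) set" where
  "complex_tangent_space \<Omega> \<xi> =
     real_tangent_space \<Omega> \<xi> \<inter> (\<lambda>v. \<i> *s v) ` real_tangent_space \<Omega> \<xi>"

definition is_inward_unit_normal :: "'a::euclidean_space set \<Rightarrow> 'a \<Rightarrow> 'a \<Rightarrow> bool" where
  "is_inward_unit_normal \<Omega> \<xi> \<eta> \<longleftrightarrow>
     norm \<eta> = 1 \<and> (\<forall>v\<in>real_tangent_space \<Omega> \<xi>. \<eta> \<bullet> v = 0) \<and>
     (\<exists>\<epsilon>>0. \<forall>t. 0 < t \<and> t < \<epsilon> \<longrightarrow> \<xi> + t *\<^sub>R \<eta> \<in> \<Omega>)"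

text \<open>Well defined on a \<open>C\<^sup>1\<close> boundary: see \<open>inward_unit_normal_ex1\<close> below.\<close>

definition inward_unit_normal :: "'a::euclidean_space set \<Rightarrow> 'a \<Rightarrow> 'a" where
  "inward_unit_normal \<Omega> \<xi> = (THE \<eta>. is_inward_unit_normal \<Omega> \<xi> \<eta>)"

definition directional_derivative :: "'a::euclidean_space \<Rightarrow> ('a \<Rightarrow> real) \<Rightarrow> 'a \<Rightarrow> real" where
  "directional_derivative v \<rho> x = deriv (\<lambda>t. \<rho> (x + t *\<^sub>R v)) 0"

definition C_strictly_convex :: "(complex ^ 'n) set \<Rightarrow> bool" where
  "C_strictly_convex \<Omega> \<longleftrightarrow>
     convex \<Omega> \<and> C1_boundary \<Omega> \<and>
     (\<forall>\<xi>\<in>frontier \<Omega>. ((+) \<xi> ` complex_tangent_space \<Omega> \<xi>) \<inter> closure \<Omega> = {\<xi>})"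

subsection \<open>Moduli of continuity\<close>

text \<open>A function on $[0, s)$ is a total function of which only the values on \<open>{0..<s}\<close> are used.\<close>

definition has_modulus_of_continuity ::
  "('a::euclidean_space \<Rightarrow> real) \<Rightarrow> 'a \<Rightarrow> real \<Rightarrow> (real \<Rightarrow> real) \<Rightarrow> bool" where
  "has_modulus_of_continuity f \<xi> r \<omega> \<longleftrightarrow>
     (\<forall>t\<in>{0..<2 * r}. 0 \<le> \<omega> t) \<and> mono_on {0..<2 * r} \<omega> \<and> \<omega> 0 = 0 \<and>
     continuous (at 0 within {0..<2 * r}) \<omega> \<and>
     (\<forall>x\<in>ball \<xi> r. \<forall>y\<in>ball \<xi> r. \<bar>f x - f y\<bar> \<le> \<omega> (norm (x - y)))"

definition dini_condition :: "real \<Rightarrow> (real \<Rightarrow> real) \<Rightarrow> bool" where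
  "dini_condition \<epsilon>\<^sub>0 g \<longleftrightarrow>
     0 < \<epsilon>\<^sub>0 \<and> (\<forall>t\<in>{0..<\<epsilon>\<^sub>0}. 0 \<le> g t) \<and>
     g \<in> borel_measurable (lebesgue_on {0..<\<epsilon>\<^sub>0}) \<and>
     (\<integral>\<^sup>+ t. ennreal (g t / t) \<partial>lebesgue_on {0..<\<epsilon>\<^sub>0}) < \<infinity>"

subsection \<open>Independence of the defining function\<close>

lemma defining_function_has_derivative:
  assumes "defining_function \<Omega> U \<rho>" "x \<in> U"
  shows "(\<rho> has_derivative frechet_derivative \<rho> (at x)) (at x)"
proof -
  have "\<rho> differentiable (at x)"
    using assms unfolding defining_function_def C1_on_def differentiable_def by blast
  then show ?thesis by (simp add: frechet_derivative_works)
qed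

lemma ray_derivative:
  fixes \<rho> :: "'a::euclidean_space \<Rightarrow> real"
  assumes "(\<rho> has_derivative D) (at \<xi>)"
  shows "((\<lambda>t. \<rho> (\<xi> + t *\<^sub>R v)) has_real_derivative D v) (at 0)"
proof -
  have lin: "linear D" using assms has_derivative_linear by blast
  have "((\<lambda>t::real. \<xi> + t *\<^sub>R v) has_derivative (\<lambda>t. t *\<^sub>R v)) (at 0)"
    by (auto intro!: derivative_eq_intros)
  moreover have "(\<rho> has_derivative D) (at (\<xi> + (0::real) *\<^sub>R v))" using assms by simp
  ultimately have "((\<lambda>t. \<rho> (\<xi> + t *\<^sub>R v)) has_derivative (\<lambda>t. D (t *\<^sub>R v))) (at 0)"
    by (rule has_derivative_compose)
  moreover have "(\<lambda>t. D (t *\<^sub>R v)) = (*) (D v)"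
    using lin by (auto simp: linear_cmul)
  ultimately show ?thesis by (simp add: has_field_derivative_def)
qed

lemma defining_function_ray_in:
  fixes \<Omega> :: "'a::euclidean_space set"
  assumes d: "defining_function \<Omega> U \<rho>" and \<xi>: "\<xi> \<in> frontier \<Omega>"
    and neg: "frechet_derivative \<rho> (at \<xi>) v < 0"
  shows "\<exists>\<epsilon>>0. \<forall>t. 0 < t \<and> t < \<epsilon> \<longrightarrow> \<xi> + t *\<^sub>R v \<in> \<Omega>"
proof -
  have U: "open U" "\<xi> \<in> U" "\<rho> \<xi> = 0" "\<Omega> \<inter> U = {x\<in>U. \<rho> x < 0}"
    using d \<xi> unfolding defining_function_def by blast+
  obtain e where e: "e > 0" "ball \<xi> e \<subseteq> U" using U openE by blast
  have "\<exists>\<delta>>0. \<forall>h>0. h < \<delta> \<longrightarrow> \<rho> (\<xi> + h *\<^sub>R v) < 0"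
    using DERIV_neg_dec_right[OF ray_derivative[OF defining_function_has_derivative[OF d U(2)]] neg]
    by (simp add: U(3))
  then obtain \<delta> where \<delta>: "\<delta> > 0" "\<And>h. 0 < h \<Longrightarrow> h < \<delta> \<Longrightarrow> \<rho> (\<xi> + h *\<^sub>R v) < 0"
    by blast
  define \<epsilon> where "\<epsilon> = min \<delta> (e / (norm v + 1))"
  have pos: "norm v + 1 > 0" by (simp add: add_nonneg_pos)
  have "\<xi> + t *\<^sub>R v \<in> \<Omega>" if t: "0 < t" "t < \<epsilon>" for t
  proof -
    have "t * norm v \<le> t * (norm v + 1)" using t by simp
    also have "\<dots> < e" using t pos unfolding \<epsilon>_def by (simp add: pos_less_divide_eq)
    finally have "\<xi> + t *\<^sub>R v \<in> ball \<xi> e" using t by (simp add: dist_norm)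
    with e \<delta>(2)[of t] t U(4) show ?thesis unfolding \<epsilon>_def by auto
  qed
  moreover have "\<epsilon> > 0" unfolding \<epsilon>_def using \<delta> e pos by simp
  ultimately show ?thesis by blast
qed

lemma defining_function_ray_le:
  fixes \<Omega> :: "'a::euclidean_space set"
  assumes d: "defining_function \<Omega> U \<rho>" and \<xi>: "\<xi> \<in> frontier \<Omega>"
    and ray: "\<exists>\<epsilon>>0. \<forall>t. 0 < t \<and> t < \<epsilon> \<longrightarrow> \<xi> + t *\<^sub>R v \<in> \<Omega>"
  shows "frechet_derivative \<rho> (at \<xi>) v \<le> 0"
proof (rule ccontr)
  have U: "open U" "\<xi> \<in> U" "\<rho> \<xi> = 0" "\<Omega> \<inter> U = {x\<in>U. \<rho> x < 0}"
    using d \<xi> unfolding defining_function_def by blast+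
  assume "\<not> ?thesis"
  then have p: "0 < frechet_derivative \<rho> (at \<xi>) v" by simp
  obtain e where e: "e > 0" "ball \<xi> e \<subseteq> U" using U openE by blast
  have "\<exists>\<delta>>0. \<forall>h>0. h < \<delta> \<longrightarrow> 0 < \<rho> (\<xi> + h *\<^sub>R v)"
    using DERIV_pos_inc_right[OF ray_derivative[OF defining_function_has_derivative[OF d U(2)]] p]
    by (simp add: U(3))
  then obtain \<delta> where \<delta>: "\<delta> > 0" "\<And>h. 0 < h \<Longrightarrow> h < \<delta> \<Longrightarrow> 0 < \<rho> (\<xi> + h *\<^sub>R v)"
    by blast
  obtain \<epsilon> where \<epsilon>: "\<epsilon> > 0" "\<And>t. 0 < t \<Longrightarrow> t < \<epsilon> \<Longrightarrow> \<xi> + t *\<^sub>R v \<in> \<Omega>" using ray by blast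
  have pos: "norm v + 1 > 0" by (simp add: add_nonneg_pos)
  define t where "t = min (min \<delta> \<epsilon>) (e / (norm v + 1)) / 2"
  have tp: "t > 0" unfolding t_def using \<delta> \<epsilon> e pos by simp
  have tl: "t < \<delta>" "t < \<epsilon>" "t < e / (norm v + 1)"
    using tp unfolding t_def by linarith+
  have "t * norm v \<le> t * (norm v + 1)" using tp by simp
  also have "\<dots> < e" using tl pos by (simp add: pos_less_divide_eq)
  finally have "\<xi> + t *\<^sub>R v \<in> U" using tp e by (auto simp: dist_norm)
  then have "\<rho> (\<xi> + t *\<^sub>R v) < 0" using \<epsilon>(2)[OF tp tl(2)] U(4) by blast
  with \<delta>(2)[OF tp tl(1)] show False by simp
qed

lemma defining_function_kernel_subset:
  fixes \<Omega> :: "'a::euclidean_space set"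
  assumes d: "defining_function \<Omega> U \<rho>" "defining_function \<Omega> V \<sigma>" and \<xi>: "\<xi> \<in> frontier \<Omega>"
    and v: "frechet_derivative \<rho> (at \<xi>) v = 0"
  shows "frechet_derivative \<sigma> (at \<xi>) v = 0"
proof (rule ccontr)
  let ?D = "frechet_derivative \<rho> (at \<xi>)" and ?E = "frechet_derivative \<sigma> (at \<xi>)"
  have "\<xi> \<in> U" "\<xi> \<in> V" using d \<xi> unfolding defining_function_def by blast+
  then have lin: "linear ?D" "linear ?E"
    using d defining_function_has_derivative has_derivative_linear by blast+
  obtain u0 where "?D u0 \<noteq> 0" using d(1) \<xi> unfolding defining_function_def by fastforce
  then have "?D u0 < 0 \<or> ?D (- u0) < 0" using linear_neg[OF lin(1), of u0] by auto
  then obtain u where u: "?D u < 0" by blast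
  assume nz: "?E v \<noteq> 0"
  define s where "s = (1 - ?E u) / ?E v"
  have "?D (u + s *\<^sub>R v) < 0" using lin(1) u v by (simp add: linear_add linear_cmul)
  then have "?E (u + s *\<^sub>R v) \<le> 0"
    using defining_function_ray_le[OF d(2) \<xi>] defining_function_ray_in[OF d(1) \<xi>] by blast
  moreover have "?E (u + s *\<^sub>R v) = 1"
    using lin(2) nz by (simp add: linear_add linear_cmul s_def)
  ultimately show False by simp
qed

lemma real_tangent_space_eq:
  fixes \<Omega> :: "'a::euclidean_space set"
  assumes "defining_function \<Omega> U \<rho>" "\<xi> \<in> frontier \<Omega>"
  shows "real_tangent_space \<Omega> \<xi> = {v. frechet_derivative \<rho> (at \<xi>) v = 0}"
  using assms defining_function_kernel_subset unfolding real_tangent_space_def by blast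

lemma inward_unit_normal_ex1:
  fixes \<Omega> :: "'a::euclidean_space set"
  assumes "C1_boundary \<Omega>" and \<xi>: "\<xi> \<in> frontier \<Omega>"
  shows "\<exists>!\<eta>. is_inward_unit_normal \<Omega> \<xi> \<eta>"
proof -
  obtain U \<rho> where d: "defining_function \<Omega> U \<rho>" using assms unfolding C1_boundary_def by blast
  let ?D = "frechet_derivative \<rho> (at \<xi>)"
  have "\<xi> \<in> U" using d \<xi> unfolding defining_function_def by blast
  then have lin: "linear ?D"
    using d defining_function_has_derivative has_derivative_linear by blast
  define g where "g = adjoint ?D 1"
  have D: "?D v = g \<bullet> v" for v
    using adjoint_works[OF lin, of v 1] by (simp add: g_def inner_commute)
  have T: "real_tangent_space \<Omega> \<xi> = {v. g \<bullet> v = 0}"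
    using real_tangent_space_eq[OF d \<xi>] D by simp
  have "?D \<noteq> (\<lambda>v. 0)" using d \<xi> unfolding defining_function_def by blast
  then have g0: "g \<noteq> 0" using D by fastforce
  show ?thesis
  proof (rule ex1I)
    let ?n = "- (1 / norm g) *\<^sub>R g"
    have "?D ?n < 0" using g0 by (simp add: D)
    then have "\<exists>\<epsilon>>0. \<forall>t. 0 < t \<and> t < \<epsilon> \<longrightarrow> \<xi> + t *\<^sub>R ?n \<in> \<Omega>"
      by (rule defining_function_ray_in[OF d \<xi>])
    moreover have "norm ?n = 1" "\<forall>v\<in>real_tangent_space \<Omega> \<xi>. ?n \<bullet> v = 0"
      using g0 by (simp_all add: T)
    ultimately show "is_inward_unit_normal \<Omega> \<xi> ?n"
      unfolding is_inward_unit_normal_def by blast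
  next
    fix \<eta> assume \<eta>: "is_inward_unit_normal \<Omega> \<xi> \<eta>"
    then have n1: "norm \<eta> = 1" and orth: "\<And>v. g \<bullet> v = 0 \<Longrightarrow> \<eta> \<bullet> v = 0"
      and le: "?D \<eta> \<le> 0"
      using defining_function_ray_le[OF d \<xi>] unfolding is_inward_unit_normal_def T by auto
    define c where "c = (g \<bullet> \<eta>) / (g \<bullet> g)"
    define w where "w = \<eta> - c *\<^sub>R g"
    have gw: "g \<bullet> w = 0" using g0 by (simp add: w_def c_def inner_diff_right)
    then have "w \<bullet> w = 0" using orth[OF gw] by (simp add: w_def inner_diff_left)
    then have e: "\<eta> = c *\<^sub>R g" by (simp add: w_def)
    have "c \<le> 0" using le by (simp add: c_def D divide_nonpos_nonneg)
    then have "- c * norm g = 1" using n1 e by simp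
    then have "c = - (1 / norm g)" using g0 by (simp add: field_simps)
    then show "\<eta> = - (1 / norm g) *\<^sub>R g" using e by simp
  qed
qed

end

theory Submission
  imports Defs "HOL-Complex_Analysis.Conformal_Mappings"
begin

text \<open>
  Write \<open>\<delta>\<close> for the distance to the boundary. By the Schwarz--Pick lemma, a complex affine
  function into the right half-plane vanishing at the boundary point nearest to \<open>z\<close> gives
  \<open>k(o, z) \<ge> - ln \<delta>(z) / 2 - C\<close> on every convex domain. If the domain is
  \<open>\<complex>\<close>-strictly convex, a chain of discs joining points near two different boundary points
  must leave both small regions where these functions are small, so both logarithms are
  picked up: \<open>k(z, w) \<ge> - ln \<delta>(z) / 2 - ln \<delta>(w) / 2 - C\<close>.
  Conversely, the Dini condition yields holomorphic discs that are almost half-planes at the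
  boundary, along which pushing \<open>z\<close> inwards to depth \<open>t\<close> costs only
  \<open>ln (t / \<delta>(z)) / 2 + C\<close>. Hence \<open>k(o, z) \<le> - ln \<delta>(z) / 2 + C\<close>, and
  \<open>k(z, w) \<le> ln t - ln \<delta>(z) / 2 - ln \<delta>(w) / 2 + C\<close> if \<open>z\<close> and \<open>w\<close> are \<open>t\<close>-close to each
  other and to the boundary. So if the images of such points under an isometry stayed apart, their
  Gromov product would be both bounded and at least \<open>- ln t - C\<close>. Therefore \<open>F\<close> is
  uniformly continuous.
\<close>

subsection \<open>The Poincar\'e distance and the Schwarz--Pick lemma for the half-plane\<close>

text \<open>Since the distance is an infimum over chains, every lower bound is proved for an
  arbitrary chain, from an estimate along single discs that adds up. The factor 1/2 before the
  logarithms comes from \<open>poincare_dist\<close>: in a half-plane, points at heights d < t above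
  the same boundary point are ln (t / d) / 2 apart. All bounds need this same factor, because at the
  end the logarithms of the boundary distances must cancel exactly. The discs for the upper bounds
  lie in the complex line spanned by the normal. Apart from the normal itself, the only real
  direction there is i times the normal, which is why the modulus concerns that derivative. Write
  d1, d2 for the two boundary distances. As F preserves distances from a base point, the lower bound
  in the first domain and the upper bound in the second give ln d2(F z) \<le> ln d1(z) + C. Hence F
  sends points near the boundary to points near the boundary, where the two-point bound is
  available, and d2 can be replaced by d1 in it. No continuity of F is assumed: away from the
  boundary it follows by comparing both Kobayashi distances with the Euclidean one.\<close>

definition disc_aut :: "complex \<Rightarrow> complex \<Rightarrow> complex" where
  "disc_aut b \<zeta> = (\<zeta> + b) / (1 + cnj b * \<zeta>)"

lemma norm_mult_cnj_less_1:
  assumes "norm (b::complex) < 1" "norm \<zeta> < 1"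
  shows "norm (cnj b * \<zeta>) < 1"
proof -
  have "norm b * norm \<zeta> \<le> norm b * 1" using assms by (intro mult_left_mono) auto
  then show ?thesis using assms by (simp add: norm_mult)
qed

lemma disc_aut_denom_nonzero:
  assumes "norm b < 1" "norm \<zeta> < 1"
  shows "1 + cnj b * \<zeta> \<noteq> 0"
  using norm_mult_cnj_less_1[OF assms]
  by (metis add_eq_0_iff less_irrefl norm_minus_cancel norm_one)

lemma norm_disc_aut_less_1:
  assumes "norm b < 1" "norm \<zeta> < 1"
  shows "norm (disc_aut b \<zeta>) < 1"
proof -
  have "(norm (1 + cnj b * \<zeta>))\<^sup>2 - (norm (\<zeta> + b))\<^sup>2 = (1 - (norm b)\<^sup>2) * (1 - (norm \<zeta>)\<^sup>2)"
    by (simp only: cmod_power2) (simp add: power2_eq_square algebra_simps)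
  moreover have "0 < (1 - (norm b)\<^sup>2) * (1 - (norm \<zeta>)\<^sup>2)"
    using assms by (intro mult_pos_pos) (auto simp: abs_square_less_1)
  ultimately have "(norm (\<zeta> + b))\<^sup>2 < (norm (1 + cnj b * \<zeta>))\<^sup>2" by linarith
  then have "norm (\<zeta> + b) < norm (1 + cnj b * \<zeta>)"
    using power_less_imp_less_base norm_ge_zero by blast
  then show ?thesis
    using disc_aut_denom_nonzero[OF assms] by (simp add: disc_aut_def norm_divide)
qed

lemma disc_aut_holomorphic:
  assumes "norm b < 1"
  shows "disc_aut b holomorphic_on ball 0 1"
  unfolding disc_aut_def using disc_aut_denom_nonzero[OF assms]
  by (auto intro!: holomorphic_intros)

lemma disc_aut_0 [simp]: "disc_aut b 0 = b"
  by (simp add: disc_aut_def)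

lemma disc_aut_inverse:
  assumes "norm b < 1" "norm a < 1"
  shows "disc_aut b (disc_aut (- b) a) = a"
proof -
  have d: "1 - cnj b * a \<noteq> 0" using disc_aut_denom_nonzero[of "- b" a] assms by simp
  have e: "1 - cnj b * b \<noteq> 0" using disc_aut_denom_nonzero[of "- b" b] assms by simp
  have n: "(a - b) / (1 - cnj b * a) + b = a * (1 - cnj b * b) / (1 - cnj b * a)"
    using d by (simp add: field_simps)
  have m: "1 + cnj b * ((a - b) / (1 - cnj b * a)) = (1 - cnj b * b) / (1 - cnj b * a)"
    using d by (simp add: field_simps)
  have "disc_aut b (disc_aut (- b) a)
      = ((a - b) / (1 - cnj b * a) + b) / (1 + cnj b * ((a - b) / (1 - cnj b * a)))"
    by (simp add: disc_aut_def)
  then show ?thesis unfolding n m using d e by simp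
qed

lemma poincare_dist_eq: "poincare_dist a b = artanh (norm (disc_aut (- b) a))"
  by (simp add: poincare_dist_def disc_aut_def)

lemma artanh_real_nonneg:
  assumes "0 \<le> x" "x < (1::real)"
  shows "0 \<le> artanh x"
  using assms by (simp add: artanh_def)

lemma artanh_real_ge_self:
  assumes "0 \<le> x" "x < (1::real)"
  shows "x \<le> artanh x"
proof -
  have "(\<lambda>t. artanh t - t) 0 \<le> (\<lambda>t. artanh t - t) x"
  proof (rule DERIV_nonneg_imp_nondecreasing[OF assms(1)])
    fix t assume t: "0 \<le> t" "t \<le> x"
    then have t1: "\<bar>t\<bar> < 1" using assms by simp
    then have "t\<^sup>2 < 1" by (simp add: abs_square_less_1)
    moreover from this have "1 \<le> 1 / (1 - t\<^sup>2)" by simp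
    moreover have "((\<lambda>t. artanh t - t) has_real_derivative 1 / (1 - t\<^sup>2) - 1) (at t)"
      using t1 by (auto intro!: derivative_eq_intros)
    ultimately show "\<exists>y. ((\<lambda>t. artanh t - t) has_real_derivative y) (at t) \<and> 0 \<le> y"
      by auto
  qed
  then show ?thesis by simp
qed

lemma artanh_real_mono:
  assumes "0 \<le> x" "x \<le> y" "y < (1::real)"
  shows "artanh x \<le> artanh y"
  using assms by (simp add: artanh_def divide_right_mono frac_le)

lemma poincare_dist_nonneg:
  assumes "norm a < 1" "norm b < 1"
  shows "0 \<le> poincare_dist a b"
  unfolding poincare_dist_eq using assms by (intro artanh_real_nonneg norm_disc_aut_less_1) auto

text \<open>Schwarz's lemma for \<open>h\<close>, which is \<open>g\<close> preceded by the disc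
  automorphism taking 0 to \<open>b\<close> and followed by the Cayley map of the right half-plane
  that takes \<open>g b\<close> to 0.\<close>

lemma Schwarz_Pick_half_plane:
  assumes g: "g holomorphic_on ball 0 1" and re: "\<And>\<zeta>. \<zeta> \<in> ball 0 1 \<Longrightarrow> 0 < Re (g \<zeta>)"
    and a: "norm a < 1" and b: "norm b < 1"
  shows "norm (g a - g b) \<le> norm (disc_aut (- b) a) * norm (g a + cnj (g b))"
proof -
  define h where "h = (\<lambda>\<zeta>. (g (disc_aut b \<zeta>) - g b) / (g (disc_aut b \<zeta>) + cnj (g b)))"
  have in_ball: "disc_aut b \<zeta> \<in> ball 0 1" if "norm \<zeta> < 1" for \<zeta>
    using norm_disc_aut_less_1[OF b that] by simp
  have gb: "0 < Re (g b)" using re b by simp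
  have ne: "g \<xi> + cnj (g b) \<noteq> 0" if "norm \<xi> < 1" for \<xi>
  proof -
    have "0 < Re (g \<xi> + cnj (g b))" using re[of \<xi>] that gb by simp
    then show ?thesis by (metis less_irrefl zero_complex.sel(1))
  qed
  have "(g \<circ> disc_aut b) holomorphic_on ball 0 1"
    by (rule holomorphic_on_compose_gen[OF disc_aut_holomorphic[OF b] g]) (use in_ball in auto)
  then have "(\<lambda>\<zeta>. g (disc_aut b \<zeta>)) holomorphic_on ball 0 1" by (simp add: o_def)
  then have hol: "h holomorphic_on ball 0 1"
    unfolding h_def using in_ball ne by (intro holomorphic_intros) auto
  have h1: "norm (h \<zeta>) < 1" if "norm \<zeta> < 1" for \<zeta>
  proof -
    let ?u = "g (disc_aut b \<zeta>)"
    have u: "0 < Re ?u" using re in_ball[OF that] by blast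
    have "(norm (?u + cnj (g b)))\<^sup>2 - (norm (?u - g b))\<^sup>2 = 4 * Re ?u * Re (g b)"
      unfolding cmod_power2 by (simp add: power2_eq_square algebra_simps)
    then have "(norm (?u - g b))\<^sup>2 < (norm (?u + cnj (g b)))\<^sup>2"
      using mult_pos_pos[OF u gb] by simp
    then have "norm (?u - g b) < norm (?u + cnj (g b))"
      using power_less_imp_less_base norm_ge_zero by blast
    then show ?thesis
      using ne[of "disc_aut b \<zeta>"] in_ball[OF that] by (simp add: h_def norm_divide)
  qed
  let ?c = "disc_aut (- b) a"
  have c: "norm ?c < 1" using norm_disc_aut_less_1[of "- b" a] a b by simp
  have "h 0 = 0" by (simp add: h_def)
  then have "norm (h ?c) \<le> norm ?c" using Schwarz_Lemma(1)[OF hol _ h1 c] by blast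
  moreover have "h ?c = (g a - g b) / (g a + cnj (g b))"
    by (simp add: h_def disc_aut_inverse a b)
  moreover have "0 < norm (g a + cnj (g b))" using ne[OF a] by simp
  ultimately show ?thesis by (simp add: norm_divide pos_divide_le_eq)
qed

text \<open>Bounding \<open>norm (g a + cnj (g b))\<close> by the sum of the moduli confines the
  ratio of the two moduli to an interval with end points \<open>q\<close> and its inverse, and
  \<open>ln q\<close> is twice the Poincare distance. The modulus is controlled, not just the real
  part.\<close>

lemma ln_quotient_le_poincare_dist:
  assumes g: "g holomorphic_on ball 0 1" and re: "\<And>\<zeta>. \<zeta> \<in> ball 0 1 \<Longrightarrow> 0 < Re (g \<zeta>)"
    and a: "norm a < 1" and b: "norm b < 1"
  shows "\<bar>ln (norm (g a)) - ln (norm (g b))\<bar> \<le> 2 * poincare_dist a b"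
proof -
  let ?m = "norm (disc_aut (- b) a)"
  have m: "0 \<le> ?m" "?m < 1" using norm_disc_aut_less_1[of "- b" a] a b by auto
  have "0 < Re (g a)" "0 < Re (g b)" using re a b by auto
  then have pos: "0 < norm (g a)" "0 < norm (g b)" by auto
  have "norm (g a - g b) \<le> ?m * norm (g a + cnj (g b))"
    using Schwarz_Pick_half_plane[OF assms] by blast
  also have "\<dots> \<le> ?m * (norm (g a) + norm (g b))"
    using norm_triangle_ineq[of "g a" "cnj (g b)"] m by (intro mult_left_mono) auto
  finally have le: "norm (g a - g b) \<le> ?m * (norm (g a) + norm (g b))" .
  have "norm (g a) - norm (g b) \<le> norm (g a - g b)" by (rule norm_triangle_ineq2)
  moreover have "norm (g b) - norm (g a) \<le> norm (g a - g b)"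
    by (metis norm_minus_commute norm_triangle_ineq2)
  ultimately have "norm (g a) \<le> norm (g b) * ((1 + ?m) / (1 - ?m))"
    "norm (g b) \<le> norm (g a) * ((1 + ?m) / (1 - ?m))"
    using le m by (auto simp: field_simps)
  moreover define q where "q = (1 + ?m) / (1 - ?m)"
  ultimately have "norm (g a) \<le> norm (g b) * q" "norm (g b) \<le> norm (g a) * q"
    by simp_all
  then have "ln (norm (g a)) \<le> ln (norm (g b) * q)" "ln (norm (g b)) \<le> ln (norm (g a) * q)"
    using pos by (auto intro!: ln_mono)
  moreover have "0 < q" unfolding q_def using m by (intro divide_pos_pos add_pos_nonneg) auto
  ultimately have "ln (norm (g a)) \<le> ln (norm (g b)) + ln q"
    "ln (norm (g b)) \<le> ln (norm (g a)) + ln q"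
    using pos by (simp_all add: ln_mult)
  then show ?thesis unfolding poincare_dist_eq artanh_def q_def[symmetric] by simp
qed

subsection \<open>Chains of discs\<close>

text \<open>Hides the index sequences of \<open>disc_chain\<close>, so that chains can be joined,
  reversed, cut and treated by induction.\<close>

definition chain_length ::
  "(complex ^ 'n) set \<Rightarrow> complex ^ 'n \<Rightarrow> complex ^ 'n \<Rightarrow> real \<Rightarrow> bool" where
  "chain_length \<Omega> z w S \<longleftrightarrow>
     (\<exists>m p f a b. disc_chain \<Omega> z w m p f a b \<and> S = (\<Sum>j<m. poincare_dist (a j) (b j)))"

lemma kobayashi_dist_eq_Inf: "kobayashi_dist \<Omega> z w = Inf {S. chain_length \<Omega> z w S}"
  unfolding kobayashi_dist_def chain_length_def by (rule arg_cong[where f = Inf]) blast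

lemma chain_length_disc:
  assumes "holomorphic_disc f \<Omega>" "norm a < 1" "norm b < 1"
  shows "chain_length \<Omega> (f a) (f b) (poincare_dist a b)"
  unfolding chain_length_def
proof (intro exI conjI)
  show "disc_chain \<Omega> (f a) (f b) 1 (\<lambda>j. if j = 0 then f a else f b) (\<lambda>_. f) (\<lambda>_. a) (\<lambda>_. b)"
    using assms by (simp add: disc_chain_def)
qed simp

lemma chain_length_extend:
  assumes "chain_length \<Omega> z (f a) S" "holomorphic_disc f \<Omega>" "norm a < 1" "norm b < 1"
  shows "chain_length \<Omega> z (f b) (S + poincare_dist a b)"
proof -
  obtain m p h c d where c: "disc_chain \<Omega> z (f a) m p h c d"
    and S: "S = (\<Sum>j<m. poincare_dist (c j) (d j))"
    using assms(1) unfolding chain_length_def by blast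
  have "disc_chain \<Omega> z (f b) (Suc m) (p(Suc m := f b)) (h(m := f)) (c(m := a)) (d(m := b))"
    using c assms(2-) unfolding disc_chain_def by (auto simp: less_Suc_eq)
  moreover have "S + poincare_dist a b
      = (\<Sum>j<Suc m. poincare_dist ((c(m := a)) j) ((d(m := b)) j))"
    unfolding S by simp
  ultimately show ?thesis unfolding chain_length_def by blast
qed

text \<open>The base case is a single disc, not the empty chain, because \<open>disc_chain\<close>
  demands \<open>0 < m\<close>; the step appends a disc at the far end.\<close>

lemma chain_length_induct [consumes 1, case_names disc extend]:
  assumes "chain_length \<Omega> z w S"
    and disc: "\<And>f a b. holomorphic_disc f \<Omega> \<Longrightarrow> norm a < 1 \<Longrightarrow> norm b < 1 \<Longrightarrow> z = f a \<Longrightarrow>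
                 P (f b) (poincare_dist a b)"
    and extend: "\<And>f a b S. chain_length \<Omega> z (f a) S \<Longrightarrow> P (f a) S \<Longrightarrow>
                   holomorphic_disc f \<Omega> \<Longrightarrow> norm a < 1 \<Longrightarrow> norm b < 1 \<Longrightarrow>
                   P (f b) (S + poincare_dist a b)"
  shows "P w S"
proof -
  obtain m p f a b where c: "disc_chain \<Omega> z w m p f a b"
    and S: "S = (\<Sum>j<m. poincare_dist (a j) (b j))"
    using assms(1) unfolding chain_length_def by blast
  have "P w (\<Sum>j<m. poincare_dist (a j) (b j))" using c
  proof (induction m arbitrary: w)
    case 0
    then show ?case by (simp add: disc_chain_def)
  next
    case (Suc m)
    have fm: "holomorphic_disc (f m) \<Omega>" "norm (a m) < 1" "norm (b m) < 1"
      "f m (a m) = p m" "w = f m (b m)" "p 0 = z"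
      using Suc.prems by (auto simp: disc_chain_def)
    show ?case
    proof (cases "m = 0")
      case True
      then show ?thesis using disc[of "f 0" "a 0" "b 0"] fm by simp
    next
      case False
      then have "disc_chain \<Omega> z (p m) m p f a b"
        using Suc.prems by (simp add: disc_chain_def)
      then have c: "disc_chain \<Omega> z (f m (a m)) m p f a b" unfolding fm(4) .
      then have "chain_length \<Omega> z (f m (a m)) (\<Sum>j<m. poincare_dist (a j) (b j))"
        unfolding chain_length_def by blast
      from extend[OF this Suc.IH[OF c] fm(1,2,3)] show ?thesis
        unfolding fm(5) by simp
    qed
  qed
  then show ?thesis using S by simp
qed

lemma chain_length_trans:
  assumes "chain_length \<Omega> x y S" "chain_length \<Omega> y z T"
  shows "chain_length \<Omega> x z (S + T)"
  using assms(2)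
proof (induction rule: chain_length_induct)
  case (disc f a b)
  then show ?case using chain_length_extend[of \<Omega> x f a S b] assms(1) by simp
next
  case (extend f a b T)
  then show ?case using chain_length_extend[of \<Omega> x f a "S + T" b] by (simp add: add.assoc)
qed

lemma chain_length_nonneg: "chain_length \<Omega> z w S \<Longrightarrow> 0 \<le> S"
  by (induction rule: chain_length_induct) (auto intro: add_nonneg_nonneg poincare_dist_nonneg)

lemma chain_length_in:
  assumes "chain_length \<Omega> z w S"
  shows "w \<in> \<Omega>"
  using assms by (cases rule: chain_length_induct) (auto simp: holomorphic_disc_def image_subset_iff)

lemma kobayashi_dist_le:
  assumes "chain_length \<Omega> z w S"
  shows "kobayashi_dist \<Omega> z w \<le> S"
  unfolding kobayashi_dist_eq_Inf
  using assms chain_length_nonneg by (intro cInf_lower bdd_belowI[where m = 0]) auto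

text \<open>The chain of length \<open>T\<close> only certifies that the set is nonempty; the
  infimum of an empty set of reals carries no information.\<close>

lemma le_kobayashi_dist:
  assumes "chain_length \<Omega> z w T" "\<And>S. chain_length \<Omega> z w S \<Longrightarrow> c \<le> S"
  shows "c \<le> kobayashi_dist \<Omega> z w"
  unfolding kobayashi_dist_eq_Inf using assms by (intro cInf_greatest) auto

lemma kobayashi_dist_triangle:
  assumes "chain_length \<Omega> x y S0" "chain_length \<Omega> y z T0"
  shows "kobayashi_dist \<Omega> x z \<le> kobayashi_dist \<Omega> x y + kobayashi_dist \<Omega> y z"
proof -
  have "kobayashi_dist \<Omega> x z - kobayashi_dist \<Omega> x y \<le> kobayashi_dist \<Omega> y z"
  proof (rule le_kobayashi_dist[OF assms(2)])
    fix T assume T: "chain_length \<Omega> y z T"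
    have "kobayashi_dist \<Omega> x z - T \<le> kobayashi_dist \<Omega> x y"
    proof (rule le_kobayashi_dist[OF assms(1)])
      fix S assume "chain_length \<Omega> x y S"
      then have "kobayashi_dist \<Omega> x z \<le> S + T"
        using chain_length_trans T kobayashi_dist_le by blast
      then show "kobayashi_dist \<Omega> x z - T \<le> S" by simp
    qed
    then show "kobayashi_dist \<Omega> x z - kobayashi_dist \<Omega> x y \<le> T" by simp
  qed
  then show ?thesis by simp
qed

lemma chain_length_ge_dist:
  fixes u :: "complex ^ 'n \<Rightarrow> 'b::metric_space"
  assumes "chain_length \<Omega> z w S"
    and "\<And>f a b. holomorphic_disc f \<Omega> \<Longrightarrow> norm a < 1 \<Longrightarrow> norm b < 1 \<Longrightarrow>
           dist (u (f a)) (u (f b)) \<le> c * poincare_dist a b"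
  shows "dist (u z) (u w) \<le> c * S"
  using assms(1)
proof (induction rule: chain_length_induct)
  case (disc f a b)
  then show ?case using assms(2) by simp
next
  case (extend f a b S)
  have "dist (u z) (u (f b)) \<le> dist (u z) (u (f a)) + dist (u (f a)) (u (f b))"
    by (rule dist_triangle)
  also have "\<dots> \<le> c * S + c * poincare_dist a b"
    using extend assms(2)[of f a b] by (intro add_mono) auto
  finally show ?case by (simp add: distrib_left)
qed

lemma poincare_dist_commute: "poincare_dist a b = poincare_dist b a"
proof -
  have "norm (1 - cnj b * a) = norm (1 - cnj a * b)"
    by (metis complex_cnj_cnj complex_cnj_diff complex_cnj_mult complex_cnj_one complex_mod_cnj
        mult.commute)
  then show ?thesis by (simp add: poincare_dist_def norm_divide norm_minus_commute)
qed

lemma chain_length_commute: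
  assumes "chain_length \<Omega> z w S"
  shows "chain_length \<Omega> w z S"
  using assms
proof (induction rule: chain_length_induct)
  case (disc f a b)
  then show ?case using chain_length_disc[of f \<Omega> b a] poincare_dist_commute by metis
next
  case (extend f a b S)
  have "chain_length \<Omega> (f b) (f a) (poincare_dist a b)"
    using chain_length_disc[of f \<Omega> b a] extend poincare_dist_commute by metis
  from chain_length_trans[OF this extend.IH] show ?case by (simp add: add.commute)
qed

lemma kobayashi_dist_commute: "kobayashi_dist \<Omega> z w = kobayashi_dist \<Omega> w z"
  unfolding kobayashi_dist_eq_Inf
  using chain_length_commute by (intro arg_cong[where f = Inf]) blast

subsection \<open>Cutting a chain at a level set\<close>

text \<open>Additivity of the Poincare distance along a radius: 0, \<open>t * m\<close> and
  \<open>m\<close> lie in this order on a geodesic.\<close>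

lemma artanh_add_segment:
  assumes "0 \<le> m" "m < (1::real)" "0 \<le> t" "t \<le> 1"
  shows "artanh (t * m) + artanh ((m - t * m) / (1 - t * m * m)) = artanh m"
proof -
  define x where "x = t * m"
  have x: "0 \<le> x" "x \<le> m" using assms by (auto simp: x_def mult_left_le_one_le)
  have "x * m \<le> 1 * m" using x assms by (intro mult_right_mono) auto
  then have xm: "x * m < 1" using assms by simp
  have p: "0 < 1 + x" "0 < 1 - x" "0 < 1 + m" "0 < 1 - m" "0 < 1 - x * m"
    using x xm assms by auto
  have "(1 + (m - x) / (1 - x * m)) / (1 - (m - x) / (1 - x * m))
      = ((1 + m) * (1 - x)) / ((1 - m) * (1 + x))"
  proof -
    have "1 + (m - x) / (1 - x * m) = (1 + m) * (1 - x) / (1 - x * m)"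
      "1 - (m - x) / (1 - x * m) = (1 - m) * (1 + x) / (1 - x * m)"
      using p by (simp_all add: field_simps)
    then show ?thesis using p by simp
  qed
  then show ?thesis
    using p by (simp add: artanh_def x_def[symmetric] ln_div ln_mult) (simp add: field_simps)
qed

text \<open>After moving \<open>a\<close> to the centre, the geodesic to the other end point is a
  radius. The intermediate value theorem finds the level \<open>e\<close> on it, and cutting a
  geodesic loses no length.\<close>

lemma disc_cut:
  fixes u :: "complex ^ 'n \<Rightarrow> real"
  assumes f: "holomorphic_disc f \<Omega>" and a: "norm a < 1" and b: "norm b < 1"
    and u: "continuous_on \<Omega> u" and le: "u (f a) \<le> e" "e \<le> u (f b)"
  shows "\<exists>x S T. u x = e \<and> chain_length \<Omega> (f a) x S \<and> chain_length \<Omega> x (f b) T \<and>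
           S + T = poincare_dist a b"
proof -
  define h where "h = f \<circ> disc_aut a"
  define c where "c = disc_aut (- a) b"
  have c: "norm c < 1" using norm_disc_aut_less_1[of "- a" b] a b by (simp add: c_def)
  have in_ball: "disc_aut a \<zeta> \<in> ball 0 1" if "\<zeta> \<in> ball 0 1" for \<zeta>
    using norm_disc_aut_less_1[OF a] that by simp
  have h: "holomorphic_disc h \<Omega>"
    unfolding holomorphic_disc_def
  proof (intro conjI allI)
    fix k
    have "(\<lambda>\<zeta>. f \<zeta> $ k) holomorphic_on ball 0 1" using f by (simp add: holomorphic_disc_def)
    then have "((\<lambda>\<zeta>. f \<zeta> $ k) \<circ> disc_aut a) holomorphic_on ball 0 1"
      by (rule holomorphic_on_compose_gen[OF disc_aut_holomorphic[OF a]]) (use in_ball in auto)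
    then show "(\<lambda>\<zeta>. h \<zeta> $ k) holomorphic_on ball 0 1" by (simp add: h_def o_def)
    show "h ` ball 0 1 \<subseteq> \<Omega>"
      using f in_ball unfolding h_def holomorphic_disc_def by fastforce
  qed
  have ends: "h 0 = f a" "h c = f b"
    using disc_aut_inverse[OF a b] by (auto simp: h_def c_def)
  have cont: "continuous_on (ball 0 1) h"
  proof -
    have "continuous_on (ball 0 1) (\<lambda>\<zeta>. \<chi> k. h \<zeta> $ k)"
      using h unfolding holomorphic_disc_def
      by (intro continuous_on_vec_lambda holomorphic_on_imp_continuous_on) auto
    then show ?thesis by simp
  qed
  have seg: "of_real t * c \<in> ball 0 1" if "0 \<le> t" "t \<le> 1" for t
    using c that mult_left_le_one_le[of "norm c" t] by (simp add: norm_mult)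
  have "continuous_on {0..1} (\<lambda>t. u (h (of_real t * c)))"
    by (rule continuous_on_compose2[OF u] continuous_on_compose2[OF cont] continuous_intros)+
      (use seg h in \<open>auto simp: holomorphic_disc_def image_subset_iff\<close>)
  then obtain t where t: "0 \<le> t" "t \<le> 1" "u (h (of_real t * c)) = e"
    using IVT'[of "\<lambda>t. u (h (of_real t * c))" 0 e 1] le ends by auto
  let ?x = "of_real t * c"
  have x1: "norm ?x < 1" using seg[OF t(1,2)] by simp
  have p1: "poincare_dist 0 ?x = artanh (t * norm c)"
    using t by (simp add: poincare_dist_def norm_mult)
  have "c - ?x = of_real (1 - t) * c" by (simp add: algebra_simps)
  moreover have "1 - cnj ?x * c = of_real (1 - t * norm c * norm c)"
  proof -
    have "cnj c * c = of_real ((norm c)\<^sup>2)" by (metis complex_norm_square mult.commute)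
    then have "of_real t * (cnj c * c) = of_real (t * (norm c * norm c))"
      by (simp add: power2_eq_square)
    then show ?thesis by (simp add: mult.assoc)
  qed
  moreover have "0 < 1 - t * norm c * norm c"
  proof -
    have "t * norm c \<le> norm c" using t by (simp add: mult_left_le_one_le)
    then have "t * norm c * norm c \<le> norm c * 1" using c t by (intro mult_mono) auto
    then show ?thesis using c by simp
  qed
  ultimately have "norm (c - ?x) = (1 - t) * norm c"
    "norm (1 - cnj ?x * c) = 1 - t * norm c * norm c"
    using t by (simp_all only: norm_mult norm_of_real)
  then have "norm ((c - ?x) / (1 - cnj ?x * c))
      = (norm c - t * norm c) / (1 - t * norm c * norm c)"
    by (simp only: norm_divide) (simp add: algebra_simps)
  then have p2: "poincare_dist ?x c = artanh ((norm c - t * norm c) / (1 - t * norm c * norm c))"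
    by (subst poincare_dist_commute) (simp add: poincare_dist_def)
  have "poincare_dist 0 ?x + poincare_dist ?x c = artanh (norm c)"
    unfolding p1 p2 using artanh_add_segment[of "norm c" t] c t by simp
  also have "\<dots> = poincare_dist a b"
    by (subst poincare_dist_commute) (simp add: poincare_dist_eq c_def)
  finally show ?thesis
    using chain_length_disc[OF h, of 0 ?x] chain_length_disc[OF h x1 c] x1 t(3) ends
    by (intro exI[of _ "h ?x"] exI conjI) auto
qed

text \<open>The cut falls in the last disc if \<open>u\<close> is still at most \<open>e\<close> at
  its start, and in the earlier part of the chain otherwise. Lower bounds for the two pieces then
  add up to one for the whole chain.\<close>

lemma chain_cut:
  fixes u :: "complex ^ 'n \<Rightarrow> real"
  assumes "chain_length \<Omega> z w S" and u: "continuous_on \<Omega> u" and z: "u z \<le> e" and "e \<le> u w"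
  shows "\<exists>x S1 S2. u x = e \<and> chain_length \<Omega> z x S1 \<and> chain_length \<Omega> x w S2 \<and> S1 + S2 = S"
  using assms(1,4)
proof (induction rule: chain_length_induct)
  case (disc f a b)
  then show ?case using disc_cut[of f \<Omega> a b u e] u z by auto
next
  case (extend f a b S)
  show ?case
  proof (cases "u (f a) \<le> e")
    case True
    then obtain x S1 S2 where x: "u x = e" "chain_length \<Omega> (f a) x S1" "chain_length \<Omega> x (f b) S2"
      "S1 + S2 = poincare_dist a b"
      using disc_cut[of f \<Omega> a b u e] u extend by auto
    have "chain_length \<Omega> z x (S + S1)" using chain_length_trans extend(1) x(2) by blast
    then show ?thesis using x by (intro exI[of _ x] exI[of _ "S + S1"] exI[of _ S2]) auto
  next
    case False
    then obtain x S1 S2 where x: "u x = e" "chain_length \<Omega> z x S1" "chain_length \<Omega> x (f a) S2"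
      "S1 + S2 = S"
      using extend by auto
    have "chain_length \<Omega> x (f b) (S2 + poincare_dist a b)"
      using chain_length_extend x(3) extend by blast
    then show ?thesis using x by (intro exI[of _ x] exI[of _ S1] exI) auto
  qed
qed

subsection \<open>Convex domains with continuously differentiable boundary\<close>

lemma ball_infdist_frontier_subset:
  fixes \<Omega> :: "'a::euclidean_space set"
  assumes "z \<in> \<Omega>" "frontier \<Omega> \<noteq> {}"
  shows "ball z (infdist z (frontier \<Omega>)) \<subseteq> \<Omega>"
proof (rule ccontr)
  let ?B = "ball z (infdist z (frontier \<Omega>))"
  assume "\<not> ?B \<subseteq> \<Omega>"
  then obtain y where y: "y \<in> ?B" "y \<notin> \<Omega>" by blast
  then have "z \<in> ?B" by (metis centre_in_ball le_less_trans mem_ball zero_le_dist)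
  then have "?B \<inter> frontier \<Omega> \<noteq> {}"
    using connected_Int_frontier[of ?B \<Omega>] connected_ball y assms(1) by blast
  then obtain x where "x \<in> frontier \<Omega>" "dist z x < infdist z (frontier \<Omega>)" by auto
  then show False using infdist_le[of x "frontier \<Omega>" z] by simp
qed

locale C1_convex_domain =
  fixes \<Omega> U :: "'a::euclidean_space set" and \<rho> :: "'a \<Rightarrow> real"
  assumes open_dom: "open \<Omega>" and nonempty: "\<Omega> \<noteq> {}" and bounded_dom: "bounded \<Omega>"
    and convex_dom: "convex \<Omega>" and defining: "defining_function \<Omega> U \<rho>"
begin

abbreviation normal :: "'a \<Rightarrow> 'a" where
  "normal \<xi> \<equiv> inward_unit_normal \<Omega> \<xi>"

abbreviation bdist :: "'a \<Rightarrow> real" where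
  "bdist z \<equiv> infdist z (frontier \<Omega>)"

lemma frontier_nonempty: "frontier \<Omega> \<noteq> {}"
  using bounded_dom nonempty not_bounded_UNIV by (auto simp: frontier_eq_empty)

lemma frontier_disjoint: "\<xi> \<in> frontier \<Omega> \<Longrightarrow> \<xi> \<notin> \<Omega>"
  using open_dom by (simp add: frontier_def interior_open)

lemma compact_frontier_dom: "compact (frontier \<Omega>)"
  using bounded_dom by (rule compact_frontier_bounded)

lemma is_normal:
  assumes "\<xi> \<in> frontier \<Omega>"
  shows "is_inward_unit_normal \<Omega> \<xi> (normal \<xi>)"
proof -
  have "C1_boundary \<Omega>" using defining unfolding C1_boundary_def by blast
  from theI'[OF inward_unit_normal_ex1[OF this assms]] show ?thesis
    unfolding inward_unit_normal_def .
qed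

lemma norm_normal: "\<xi> \<in> frontier \<Omega> \<Longrightarrow> norm (normal \<xi>) = 1"
  using is_normal by (simp add: is_inward_unit_normal_def)

text \<open>The normal annihilates the kernel of the differential, hence is a multiple
  \<open>c\<close> of the gradient \<open>g\<close>. The ray along it enters the domain, where
  \<rho> is negative, so \<open>c < 0\<close> and \<open>G\<close> is
  \<open>- 1 / c\<close>.\<close>

lemma derivative_eq_normal:
  assumes \<xi>: "\<xi> \<in> frontier \<Omega>"
  obtains G where "0 < G" "\<And>v. frechet_derivative \<rho> (at \<xi>) v = - G * (normal \<xi> \<bullet> v)"
proof -
  let ?D = "frechet_derivative \<rho> (at \<xi>)" and ?\<eta> = "normal \<xi>"
  have "\<xi> \<in> U" using defining \<xi> unfolding defining_function_def by blast
  then have lin: "linear ?D"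
    using defining defining_function_has_derivative has_derivative_linear by blast
  define g where "g = adjoint ?D 1"
  have D: "?D v = g \<bullet> v" for v
    using adjoint_works[OF lin, of v 1] by (simp add: g_def inner_commute)
  have T: "real_tangent_space \<Omega> \<xi> = {v. g \<bullet> v = 0}"
    using real_tangent_space_eq[OF defining \<xi>] D by simp
  have "?D \<noteq> (\<lambda>v. 0)" using defining \<xi> unfolding defining_function_def by blast
  then have g0: "g \<noteq> 0" using D by fastforce
  have n1: "norm ?\<eta> = 1" and orth: "\<And>v. g \<bullet> v = 0 \<Longrightarrow> ?\<eta> \<bullet> v = 0" and le: "?D ?\<eta> \<le> 0"
    using is_normal[OF \<xi>] defining_function_ray_le[OF defining \<xi>]
    unfolding is_inward_unit_normal_def T by auto
  define w where "w = g - (g \<bullet> ?\<eta>) *\<^sub>R ?\<eta>"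
  define c where "c = (g \<bullet> ?\<eta>) / (g \<bullet> g)"
  have "g \<bullet> (?\<eta> - c *\<^sub>R g) = 0" using g0 by (simp add: c_def inner_diff_right)
  from this orth[OF this] have "(?\<eta> - c *\<^sub>R g) \<bullet> (?\<eta> - c *\<^sub>R g) = 0"
    by (simp add: inner_diff_left)
  then have e: "?\<eta> = c *\<^sub>R g" by simp
  then have c0: "c \<noteq> 0" using n1 by auto
  then have ge: "g = (1 / c) *\<^sub>R ?\<eta>" using e by simp
  have "?D ?\<eta> = 1 / c" using n1 by (subst D, subst ge) (simp add: norm_eq_1)
  then have "1 / c < 0" using le c0 by (simp add: order_less_le)
  moreover have "?D v = - (- 1 / c) * (?\<eta> \<bullet> v)" for v by (subst D, subst ge) simp
  ultimately show ?thesis using that[of "- 1 / c"] by simp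
qed

text \<open>By convexity the domain lies on one side of the tangent hyperplane. Moving
  \<open>x\<close> by \<open>s < d\<close> against the normal stays in the ball and lowers the
  height by \<open>s\<close>; then \<open>s\<close> tends to \<open>d\<close>.\<close>

lemma normal_inner_ge:
  assumes \<xi>: "\<xi> \<in> frontier \<Omega>" and d: "0 < d" and ball: "ball x d \<subseteq> \<Omega>"
  shows "d \<le> normal \<xi> \<bullet> (x - \<xi>)"
proof -
  have nonneg: "0 \<le> normal \<xi> \<bullet> (y - \<xi>)" if y: "y \<in> \<Omega>" for y
  proof -
    have "\<xi> + t *\<^sub>R (y - \<xi>) \<in> \<Omega>" if t: "0 < t" "t < 1" for t
      using mem_interior_closure_convex_shrink[OF convex_dom, of y \<xi> t] y \<xi> t open_dom
      by (simp add: interior_open frontier_def algebra_simps)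
    then have "frechet_derivative \<rho> (at \<xi>) (y - \<xi>) \<le> 0"
      by (intro defining_function_ray_le[OF defining \<xi>] exI[of _ 1]) auto
    then show ?thesis
      using derivative_eq_normal[OF \<xi>] by (metis mult_minus_left neg_le_0_iff_le zero_le_mult_iff
        not_less order_less_le)
  qed
  have "s \<le> normal \<xi> \<bullet> (x - \<xi>)" if s: "0 < s" "s < d" for s
  proof -
    have "x - s *\<^sub>R normal \<xi> \<in> ball x d" using s norm_normal[OF \<xi>] by (simp add: dist_norm)
    then have "0 \<le> normal \<xi> \<bullet> (x - s *\<^sub>R normal \<xi> - \<xi>)" using ball nonneg by blast
    moreover have "normal \<xi> \<bullet> (x - s *\<^sub>R normal \<xi> - \<xi>) = normal \<xi> \<bullet> (x - \<xi>) - s"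
      using norm_normal[OF \<xi>] by (simp add: inner_diff_right norm_eq_1)
    ultimately show ?thesis by simp
  qed
  then show ?thesis by (meson d dense_le_bounded)
qed

lemma normal_inner_pos:
  assumes "\<xi> \<in> frontier \<Omega>" "x \<in> \<Omega>"
  shows "0 < normal \<xi> \<bullet> (x - \<xi>)"
proof -
  obtain d where "0 < d" "ball x d \<subseteq> \<Omega>" using open_dom assms(2) openE by blast
  then show ?thesis using normal_inner_ge[OF assms(1)] by fastforce
qed

lemma ball_bdist_subset: "z \<in> \<Omega> \<Longrightarrow> ball z (bdist z) \<subseteq> \<Omega>"
  using ball_infdist_frontier_subset frontier_nonempty by blast

lemma bdist_pos: "z \<in> \<Omega> \<Longrightarrow> 0 < bdist z"
  using infdist_pos_not_in_closed[OF frontier_closed frontier_nonempty] frontier_disjoint by blast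

text \<open>For a nearest boundary point, \<open>normal_inner_ge\<close> forces equality in the
  Cauchy-Schwarz inequality for the unit normal and \<open>z - \<xi>\<close>, so that
  \<open>z\<close> lies on the normal.\<close>

lemma bdist_attained:
  assumes "z \<in> \<Omega>"
  obtains \<xi> where "\<xi> \<in> frontier \<Omega>" "z = \<xi> + bdist z *\<^sub>R normal \<xi>"
proof -
  let ?d = "bdist z"
  obtain \<xi> where \<xi>: "\<xi> \<in> frontier \<Omega>" "infdist z (frontier \<Omega>) = dist z \<xi>"
    using infdist_attains_inf[OF frontier_closed frontier_nonempty] by blast
  let ?n = "normal \<xi>"
  have "?d \<le> ?n \<bullet> (z - \<xi>)"
    using normal_inner_ge[OF \<xi>(1)] bdist_pos ball_bdist_subset assms by blast
  then have le: "?d * ?d \<le> ?d * (?n \<bullet> (z - \<xi>))" by (intro mult_left_mono) (auto simp: infdist_nonneg)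
  have zx: "(z - \<xi>) \<bullet> (z - \<xi>) = ?d * ?d"
    using \<xi>(2) by (simp add: dist_norm dot_square_norm power2_eq_square)
  have nn: "?n \<bullet> ?n = 1" using norm_normal[OF \<xi>(1)] by (simp add: norm_eq_1)
  have "(z - \<xi> - ?d *\<^sub>R ?n) \<bullet> (z - \<xi> - ?d *\<^sub>R ?n)
      = (z - \<xi>) \<bullet> (z - \<xi>) - 2 * (?d * (?n \<bullet> (z - \<xi>))) + ?d * ?d * (?n \<bullet> ?n)"
    by (simp add: inner_diff_left inner_diff_right inner_commute algebra_simps)
  also have "\<dots> \<le> 0" unfolding zx nn using le by simp
  finally have "z - \<xi> - ?d *\<^sub>R ?n = 0" by (metis inner_eq_zero_iff inner_ge_zero order_antisym)
  then show ?thesis using that[OF \<xi>(1)] by (simp add: algebra_simps)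
qed

section \<open>Uniform first-order estimates along the compact boundary\<close>

lemma C1_derivative:
  obtains \<rho>' :: "'a \<Rightarrow> 'a \<Rightarrow>\<^sub>L real"
  where "\<And>x. x \<in> U \<Longrightarrow> (\<rho> has_derivative blinfun_apply (\<rho>' x)) (at x)" "continuous_on U \<rho>'"
  using defining unfolding defining_function_def C1_on_def by blast

lemma frontier_subset_nbhd: "frontier \<Omega> \<subseteq> U"
  using defining by (simp add: defining_function_def)

lemma derivative_eq_norm_normal:
  assumes \<xi>: "\<xi> \<in> frontier \<Omega>" and D: "(\<rho> has_derivative blinfun_apply D) (at \<xi>)"
  shows "0 < norm D" "blinfun_apply D v = - norm D * (normal \<xi> \<bullet> v)"
proof -
  obtain G where G: "0 < G" "\<And>v. frechet_derivative \<rho> (at \<xi>) v = - G * (normal \<xi> \<bullet> v)"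
    using derivative_eq_normal[OF \<xi>] by blast
  then have Dv: "blinfun_apply D v = - G * (normal \<xi> \<bullet> v)" for v
    using frechet_derivative_at[OF D] by metis
  have "norm D \<le> G"
  proof (rule norm_blinfun_bound)
    fix v
    have "\<bar>normal \<xi> \<bullet> v\<bar> \<le> norm v"
      using Cauchy_Schwarz_ineq2[of "normal \<xi>" v] norm_normal[OF \<xi>] by simp
    then show "norm (blinfun_apply D v) \<le> G * norm v"
      using G(1) by (simp add: Dv abs_mult)
  qed (use G in simp)
  moreover have "G \<le> norm D"
    using norm_blinfun[of D "normal \<xi>"] norm_normal[OF \<xi>] G(1)
    by (simp add: Dv dot_square_norm)
  ultimately have "norm D = G" by simp
  then show "0 < norm D" "blinfun_apply D v = - norm D * (normal \<xi> \<bullet> v)" using G Dv by auto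
qed

lemma continuous_on_normal: "continuous_on (frontier \<Omega>) normal"
proof -
  obtain \<rho>' where \<rho>': "\<And>x. x \<in> U \<Longrightarrow> (\<rho> has_derivative blinfun_apply (\<rho>' x)) (at x)"
    "continuous_on U \<rho>'" using C1_derivative by blast
  have pos: "0 < norm (\<rho>' \<xi>)" and eq: "blinfun_apply (\<rho>' \<xi>) v = - norm (\<rho>' \<xi>) * (normal \<xi> \<bullet> v)"
    if "\<xi> \<in> frontier \<Omega>" for \<xi> v
    using derivative_eq_norm_normal[OF that \<rho>'(1)] that frontier_subset_nbhd by blast+
  have c: "continuous_on (frontier \<Omega>) \<rho>'"
    using \<rho>'(2) frontier_subset_nbhd continuous_on_subset by blast
  have "continuous_on (frontier \<Omega>) (\<lambda>\<xi>. normal \<xi> \<bullet> i)" for i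
  proof -
    have "continuous_on (frontier \<Omega>) (\<lambda>\<xi>. - blinfun_apply (\<rho>' \<xi>) i / norm (\<rho>' \<xi>))"
      by (intro continuous_intros c) (use pos in force)
    moreover have "- blinfun_apply (\<rho>' \<xi>) i / norm (\<rho>' \<xi>) = normal \<xi> \<bullet> i"
      if "\<xi> \<in> frontier \<Omega>" for \<xi>
      using pos[OF that] eq[OF that, of i] by simp
    ultimately show ?thesis by (simp cong: continuous_on_cong)
  qed
  then show ?thesis using continuous_on_componentwise by blast
qed

text \<open>By compactness the gradient has norm at least \<open>4 * c\<close> on the boundary and,
  by uniform continuity on the compact neighbourhood \<open>K\<close>, varies by at most
  \<open>c\<close> within distance \<open>e\<close> of a boundary point. The mean value inequality
  for \<rho> minus its linear part gives the bound. The ratio 4 to 1 leaves room for vectors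
  \<open>u\<close> tilted away from the normal.\<close>

lemma defining_function_upper_bound:
  obtains c e where "0 < c" "0 < e"
    "\<And>\<xi> u. \<xi> \<in> frontier \<Omega> \<Longrightarrow> norm u \<le> e \<Longrightarrow> 0 \<le> normal \<xi> \<bullet> u \<Longrightarrow>
       \<xi> + u \<in> U \<and> \<rho> (\<xi> + u) \<le> - 4 * c * (normal \<xi> \<bullet> u) + c * norm u"
proof -
  obtain \<rho>' where \<rho>': "\<And>x. x \<in> U \<Longrightarrow> (\<rho> has_derivative blinfun_apply (\<rho>' x)) (at x)"
    "continuous_on U \<rho>'" using C1_derivative by blast
  have inU: "\<And>\<xi>. \<xi> \<in> frontier \<Omega> \<Longrightarrow> \<xi> \<in> U" using frontier_subset_nbhd by blast
  have c: "continuous_on (frontier \<Omega>) (\<lambda>\<xi>. norm (\<rho>' \<xi>))"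
    using \<rho>'(2) frontier_subset_nbhd continuous_on_subset continuous_on_norm by blast
  obtain \<xi>0 where \<xi>0: "\<xi>0 \<in> frontier \<Omega>" "\<And>\<xi>. \<xi> \<in> frontier \<Omega> \<Longrightarrow> norm (\<rho>' \<xi>0) \<le> norm (\<rho>' \<xi>)"
    using continuous_attains_inf[OF compact_frontier_dom frontier_nonempty c] by blast
  define c where "c = norm (\<rho>' \<xi>0) / 4"
  have c0: "0 < c" using derivative_eq_norm_normal(1)[OF \<xi>0(1) \<rho>'(1)] inU \<xi>0 by (simp add: c_def)
  have cle: "4 * c \<le> norm (\<rho>' \<xi>)" if "\<xi> \<in> frontier \<Omega>" for \<xi> using \<xi>0(2)[OF that] by (simp add: c_def)
  have "open U" using defining by (simp add: defining_function_def)
  then obtain e1 where e1: "0 < e1" "(\<Union>x\<in>frontier \<Omega>. ball x e1) \<subseteq> U"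
    using compact_subset_open_imp_ball_epsilon_subset[OF compact_frontier_dom _ frontier_subset_nbhd]
    by metis
  define K where "K = {x. infdist x (frontier \<Omega>) \<le> e1 / 2}"
  have "compact K" unfolding K_def
    using e1(1) by (intro compact_infdist_le[OF frontier_nonempty compact_frontier_dom]) simp
  have KU: "K \<subseteq> U"
  proof
    fix x assume x: "x \<in> K"
    obtain \<xi> where "\<xi> \<in> frontier \<Omega>" "infdist x (frontier \<Omega>) = dist x \<xi>"
      using infdist_attains_inf[OF frontier_closed frontier_nonempty] by blast
    then show "x \<in> U" using x e1 unfolding K_def
      by (metis (no_types, lifting) UN_I dist_commute field_sum_of_halves less_add_same_cancel1
          half_gt_zero mem_Collect_eq mem_ball order_le_less_trans subsetD)
  qed
  then have "uniformly_continuous_on K \<rho>'"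
    using compact_uniformly_continuous \<open>compact K\<close> \<rho>'(2) continuous_on_subset by blast
  then obtain e2 where e2: "0 < e2"
    "\<And>x y. x \<in> K \<Longrightarrow> y \<in> K \<Longrightarrow> dist y x < e2 \<Longrightarrow> dist (\<rho>' y) (\<rho>' x) < c"
    unfolding uniformly_continuous_on_def using c0 by metis
  define e where "e = min (e1 / 2) (e2 / 2)"
  have e0: "0 < e" using e1 e2 by (simp add: e_def)
  show ?thesis
  proof (rule that[OF c0 e0])
    fix \<xi> u
    assume \<xi>: "\<xi> \<in> frontier \<Omega>" and u: "norm u \<le> e" and un: "0 \<le> normal \<xi> \<bullet> u"
    have inK: "x \<in> K" if "x \<in> cball \<xi> e" for x
      using infdist_le[OF \<xi>, of x] that by (auto simp: K_def e_def dist_commute)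
    have \<xi>c: "\<xi> \<in> cball \<xi> e" "\<xi> + u \<in> cball \<xi> e" using e0 u by (auto simp: dist_norm)
    have deriv: "((\<lambda>x. \<rho> x - blinfun_apply (\<rho>' \<xi>) x) has_derivative
        blinfun_apply (\<rho>' x - \<rho>' \<xi>)) (at x within cball \<xi> e)" if "x \<in> cball \<xi> e" for x
      unfolding minus_blinfun.rep_eq
      using \<rho>'(1) inK[OF that] KU
      by (intro has_derivative_diff bounded_linear_imp_has_derivative blinfun.bounded_linear_right)
        (blast intro: has_derivative_at_withinI)
    have small: "onorm (blinfun_apply (\<rho>' x - \<rho>' \<xi>)) \<le> c" if "x \<in> cball \<xi> e" for x
    proof -
      have "dist x \<xi> < e2" using that e0 e2(1) by (auto simp: e_def dist_commute min_def split: if_splits)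
      then have "dist (\<rho>' x) (\<rho>' \<xi>) < c" using e2(2)[OF inK[OF \<xi>c(1)] inK[OF that]] by simp
      then show ?thesis by (simp add: dist_norm norm_blinfun.rep_eq)
    qed
    have "norm ((\<rho> (\<xi> + u) - blinfun_apply (\<rho>' \<xi>) (\<xi> + u)) - (\<rho> \<xi> - blinfun_apply (\<rho>' \<xi>) \<xi>))
        \<le> c * norm ((\<xi> + u) - \<xi>)"
      by (rule differentiable_bound[OF convex_cball deriv small \<xi>c(2,1)])
    moreover have "\<rho> \<xi> = 0" using defining \<xi> by (auto simp: defining_function_def)
    ultimately have "\<rho> (\<xi> + u) \<le> blinfun_apply (\<rho>' \<xi>) u + c * norm u"
      by (simp add: blinfun.add_right)
    also have "blinfun_apply (\<rho>' \<xi>) u = - norm (\<rho>' \<xi>) * (normal \<xi> \<bullet> u)"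
      using derivative_eq_norm_normal(2)[OF \<xi> \<rho>'(1)] inU[OF \<xi>] by blast
    also have "\<dots> \<le> - 4 * c * (normal \<xi> \<bullet> u)"
      using mult_right_mono[OF cle[OF \<xi>] un] by simp
    finally show "\<xi> + u \<in> U \<and> \<rho> (\<xi> + u) \<le> - 4 * c * (normal \<xi> \<bullet> u) + c * norm u"
      using inK[OF \<xi>c(2)] KU by auto
  qed
qed

lemma mem_dom_iff_nbhd: "x \<in> U \<Longrightarrow> x \<in> \<Omega> \<longleftrightarrow> \<rho> x < 0"
  using defining unfolding defining_function_def by blast

text \<open>A point of the ball differs from \<xi> by a vector of norm at most 5/4 t with normal
  component at least 3/4 t, and the upper bound for \<rho> becomes - 3 c t + 5/4 c t < 0. Thus depth
  along the normal is comparable to the distance to the boundary.\<close>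

lemma interior_ball_on_normal:
  obtains t0 where "0 < t0"
    "\<And>\<xi> t. \<xi> \<in> frontier \<Omega> \<Longrightarrow> 0 < t \<Longrightarrow> t \<le> t0 \<Longrightarrow> ball (\<xi> + t *\<^sub>R normal \<xi>) (t / 4) \<subseteq> \<Omega>"
proof -
  obtain c e where c: "0 < c" and e: "0 < e" and bound:
    "\<And>\<xi> u. \<xi> \<in> frontier \<Omega> \<Longrightarrow> norm u \<le> e \<Longrightarrow> 0 \<le> normal \<xi> \<bullet> u \<Longrightarrow>
       \<xi> + u \<in> U \<and> \<rho> (\<xi> + u) \<le> - 4 * c * (normal \<xi> \<bullet> u) + c * norm u"
    using defining_function_upper_bound by blast
  show ?thesis
  proof (rule that[of "e / 2"])
    show "ball (\<xi> + t *\<^sub>R normal \<xi>) (t / 4) \<subseteq> \<Omega>"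
      if \<xi>: "\<xi> \<in> frontier \<Omega>" and t: "0 < t" "t \<le> e / 2" for \<xi> t
    proof
      fix x assume "x \<in> ball (\<xi> + t *\<^sub>R normal \<xi>) (t / 4)"
      define v where "v = x - (\<xi> + t *\<^sub>R normal \<xi>)"
      have v: "norm v \<le> t / 4"
        using \<open>x \<in> _\<close> by (simp add: v_def dist_norm norm_minus_commute)
      define u where "u = t *\<^sub>R normal \<xi> + v"
      have "norm u \<le> t + norm v"
        unfolding u_def using norm_triangle_ineq[of "t *\<^sub>R normal \<xi>" v] norm_normal[OF \<xi>] t by simp
      then have nu: "norm u \<le> 5 / 4 * t" using v by simp
      have "\<bar>normal \<xi> \<bullet> v\<bar> \<le> norm v"
        using Cauchy_Schwarz_ineq2[of "normal \<xi>" v] norm_normal[OF \<xi>] by simp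
      moreover have "normal \<xi> \<bullet> u = t + normal \<xi> \<bullet> v"
        using norm_normal[OF \<xi>] by (simp add: u_def inner_add_right norm_eq_1)
      ultimately have iu: "3 / 4 * t \<le> normal \<xi> \<bullet> u" using v by simp
      have "c * (3 / 4 * t) \<le> c * (normal \<xi> \<bullet> u)" "c * norm u \<le> c * (5 / 4 * t)"
        using iu nu c by (intro mult_left_mono; simp)+
      moreover have "0 < c * t" using c t by simp
      ultimately have "- 4 * c * (normal \<xi> \<bullet> u) + c * norm u < 0" by simp
      moreover have "\<xi> + u \<in> U \<and> \<rho> (\<xi> + u) \<le> - 4 * c * (normal \<xi> \<bullet> u) + c * norm u"
        using bound[OF \<xi>] nu iu t by simp
      ultimately have "\<xi> + u \<in> \<Omega>" using mem_dom_iff_nbhd by force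
      moreover have "\<xi> + u = x" by (simp add: u_def v_def)
      ultimately show "x \<in> \<Omega>" by simp
    qed
  qed (use e in simp)
qed

end

subsection \<open>Chains in convex domains\<close>

lemma norm_complex_scaleV: "norm (c *s v) = norm c * norm (v :: complex ^ 'n)"
  by (simp add: norm_vec_def norm_mult L2_set_right_distrib)

lemma holomorphic_disc_line:
  assumes "ball p b \<subseteq> \<Omega>" "norm v \<le> b" "0 < b"
  shows "holomorphic_disc (\<lambda>\<zeta>. p + \<zeta> *s v) \<Omega>"
  unfolding holomorphic_disc_def
proof (intro conjI allI image_subsetI)
  fix \<zeta> :: complex assume "\<zeta> \<in> ball 0 1"
  then have "norm \<zeta> * norm v < 1 * norm v \<or> v = 0"
    using mult_strict_right_mono[of "norm \<zeta>" 1 "norm v"] by auto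
  then have "norm (\<zeta> *s v) < b" using assms(2,3) by (auto simp: norm_complex_scaleV)
  then show "p + \<zeta> *s v \<in> \<Omega>" using assms(1) by (auto simp: dist_norm)
qed (auto intro!: holomorphic_intros)

lemma chain_length_in_ball:
  assumes "ball p b \<subseteq> \<Omega>" "norm (q - p) < b"
  shows "chain_length \<Omega> p q (artanh (norm (q - p) / b))"
proof -
  have b: "0 < b" using assms(2) by (smt (verit) norm_ge_zero)
  \<comment> \<open>If \<open>q = p\<close>, division by zero makes \<open>v\<close> zero and the
    disc constant.\<close>
  define v where "v = (b / norm (q - p)) *\<^sub>R (q - p)"
  have "norm v \<le> b" using b by (simp add: v_def)
  note disc = holomorphic_disc_line[OF assms(1) this b]
  let ?x = "complex_of_real (norm (q - p) / b)"
  have x: "norm ?x = norm (q - p) / b" using b by (simp only: norm_of_real) simp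
  have "?x *s v = (norm (q - p) / b) *\<^sub>R v" by (simp add: vec_eq_iff scaleR_conv_of_real[where 'a = complex])
  also have "\<dots> = q - p" using b by (simp add: v_def)
  finally have "p + ?x *s v = q" by simp
  moreover have "norm ?x < 1" using x assms(2) b by simp
  moreover have "poincare_dist 0 ?x = artanh (norm (q - p) / b)"
    unfolding poincare_dist_def using x by simp
  ultimately show ?thesis using chain_length_disc[OF disc, of 0 ?x] by simp
qed

lemma convex_ball_subset:
  fixes \<Omega> :: "'a::real_normed_vector set"
  assumes "convex \<Omega>" "ball p b \<subseteq> \<Omega>" "ball q b \<subseteq> \<Omega>" "0 \<le> t" "t \<le> 1"
  shows "ball (p + t *\<^sub>R (q - p)) b \<subseteq> \<Omega>"
proof
  fix x assume x: "x \<in> ball (p + t *\<^sub>R (q - p)) b"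
  define v where "v = x - (p + t *\<^sub>R (q - p))"
  have "norm v < b" using x by (simp add: v_def dist_norm norm_minus_commute)
  then have "p + v \<in> ball p b" "q + v \<in> ball q b" by (simp_all add: dist_norm)
  then have "p + v \<in> \<Omega>" "q + v \<in> \<Omega>" using assms(2,3) by blast+
  then have "(1 - t) *\<^sub>R (p + v) + t *\<^sub>R (q + v) \<in> \<Omega>"
    using convexD_alt[OF assms(1)] assms(4,5) by blast
  moreover have "(1 - t) *\<^sub>R (p + v) + t *\<^sub>R (q + v) = x" by (simp add: v_def algebra_simps)
  ultimately show "x \<in> \<Omega>" by simp
qed

text \<open>Equally spaced points on the segment are centres of balls of radius \<open>b\<close> in
  the domain, and neighbouring ones are at most \<open>b / 2\<close> apart. The bound depends only
  on the ratio of distance to \<open>b\<close>, hence is invariant under scaling.\<close>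

lemma chain_length_convex:
  assumes "convex \<Omega>" "ball p b \<subseteq> \<Omega>" "ball q b \<subseteq> \<Omega>" "0 < b"
    and n: "0 < n" "norm (q - p) \<le> real n * b / 2"
  shows "\<exists>S \<le> real n * artanh (1 / 2). chain_length \<Omega> p q S"
proof -
  let ?x = "\<lambda>k. p + (real k / real n) *\<^sub>R (q - p)"
  have "\<exists>S \<le> real k * artanh (1 / 2). chain_length \<Omega> p (?x k) S" if "k \<le> n" for k
    using that
  proof (induction k)
    case 0
    show ?case using chain_length_in_ball[OF assms(2), of p] assms(4) by auto
  next
    case (Suc k)
    then obtain S where S: "S \<le> real k * artanh (1 / 2)" "chain_length \<Omega> p (?x k) S" by auto
    have ball: "ball (?x k) b \<subseteq> \<Omega>"
      using Suc.prems by (intro convex_ball_subset assms) auto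
    have "?x (Suc k) - ?x k = (1 / real n) *\<^sub>R (q - p)"
      by (simp add: add_divide_distrib algebra_simps)
    then have "norm (?x (Suc k) - ?x k) = norm (q - p) / real n" by simp
    moreover have "norm (q - p) / real n \<le> b / 2" using n by (simp add: field_simps)
    ultimately have le: "norm (?x (Suc k) - ?x k) \<le> b / 2" by (simp only:)
    then have "chain_length \<Omega> (?x k) (?x (Suc k)) (artanh (norm (?x (Suc k) - ?x k) / b))"
      using assms(4) by (intro chain_length_in_ball ball) simp
    moreover have "artanh (norm (?x (Suc k) - ?x k) / b) \<le> artanh (1 / 2)"
      using le assms(4) by (intro artanh_real_mono) (auto simp: field_simps)
    ultimately have "S + artanh (norm (?x (Suc k) - ?x k) / b) \<le> real (Suc k) * artanh (1 / 2)"
      "chain_length \<Omega> p (?x (Suc k)) (S + artanh (norm (?x (Suc k) - ?x k) / b))"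
      using S(1) chain_length_trans[OF S(2)] by (simp_all only: of_nat_Suc distrib_right)
    then show ?case by blast
  qed
  from this[of n] n show ?thesis by simp
qed

subsection \<open>Lower bounds for the Kobayashi distance\<close>

text \<open>Complex linear in the first argument, so composing it with a holomorphic disc is
  holomorphic; its real part is the Euclidean inner product.\<close>

definition cinner :: "complex ^ 'n \<Rightarrow> complex ^ 'n \<Rightarrow> complex" where
  "cinner v w = (\<Sum>k\<in>UNIV. v $ k * cnj (w $ k))"

lemma Re_cinner: "Re (cinner v w) = v \<bullet> w"
  by (simp add: cinner_def inner_vec_def inner_complex_def)

lemma Im_cinner: "Im (cinner v w) = v \<bullet> (\<i> *s w)"
  by (simp add: cinner_def inner_vec_def inner_complex_def algebra_simps)

lemma cinner_scale_left: "cinner (c *s v) w = c * cinner v w"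
  by (simp add: cinner_def sum_distrib_left mult.assoc)

lemma cinner_scaleR_left: "cinner (c *\<^sub>R v) w = of_real c * cinner v w"
  by (simp add: cinner_def sum_distrib_left scaleR_conv_of_real[where 'a = complex] mult.assoc)

lemma cinner_self: "cinner v v = of_real ((norm v)\<^sup>2)"
proof -
  have "(norm v)\<^sup>2 = (\<Sum>k\<in>UNIV. (norm (v $ k))\<^sup>2)"
    by (simp add: norm_vec_def L2_set_def sum_nonneg)
  then show ?thesis by (simp add: cinner_def flip: complex_norm_square)
qed

text \<open>Adding \<open>R\<close> to a coordinate maps each disc into the right half-plane, where
  Schwarz-Pick applies with a second factor of at most \<open>4 * R\<close>. Summing over the
  coordinates gives the factor \<open>CARD('n)\<close>.\<close>

lemma bounded_chain_length_ge_norm: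
  fixes \<Omega> :: "(complex ^ 'n) set"
  assumes "bounded \<Omega>"
  obtains c where "0 < c" "\<And>z w S. chain_length \<Omega> z w S \<Longrightarrow> norm (z - w) \<le> c * S"
proof -
  obtain R where R: "0 < R" "\<And>x. x \<in> \<Omega> \<Longrightarrow> norm x < R"
    using assms bounded_pos_less by blast
  let ?c = "real CARD('n) * (4 * R)"
  show ?thesis
  proof (rule that[of ?c])
    show "norm (z - w) \<le> ?c * S" if "chain_length \<Omega> z w S" for z w S
    proof -
      have "dist (f a) (f b) \<le> ?c * poincare_dist a b"
        if f: "holomorphic_disc f \<Omega>" and a: "norm a < 1" and b: "norm b < 1" for f a b
      proof -
        have comp: "norm ((f a - f b) $ k) \<le> 4 * R * poincare_dist a b" for k
        proof -
          let ?g = "\<lambda>\<zeta>. f \<zeta> $ k + of_real R"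
          have lt: "norm (f \<zeta> $ k) < R" if "\<zeta> \<in> ball 0 1" for \<zeta>
          proof -
            have "f \<zeta> \<in> \<Omega>" using f that unfolding holomorphic_disc_def by blast
            from R(2)[OF this] Finite_Cartesian_Product.norm_nth_le[of "f \<zeta>" k] show ?thesis by simp
          qed
          have "?g holomorphic_on ball 0 1"
            using f unfolding holomorphic_disc_def by (intro holomorphic_intros) auto
          moreover have "0 < Re (?g \<zeta>)" if "\<zeta> \<in> ball 0 1" for \<zeta>
            using lt[OF that] abs_Re_le_cmod[of "f \<zeta> $ k"] by simp
          ultimately have "norm (?g a - ?g b) \<le> norm (disc_aut (- b) a) * norm (?g a + cnj (?g b))"
            using a b by (intro Schwarz_Pick_half_plane) auto
          also have "\<dots> \<le> poincare_dist a b * (4 * R)"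
          proof (intro mult_mono poincare_dist_nonneg a b)
            show "norm (disc_aut (- b) a) \<le> poincare_dist a b"
              unfolding poincare_dist_eq using norm_disc_aut_less_1[of "- b" a] a b
              by (intro artanh_real_ge_self) auto
            have "norm (?g \<zeta>) \<le> 2 * R" if "norm \<zeta> < 1" for \<zeta>
              using norm_triangle_ineq[of "f \<zeta> $ k" "of_real R"] lt[of \<zeta>] that R by simp
            from this[OF a] this[OF b] show "norm (?g a + cnj (?g b)) \<le> 4 * R"
              by (smt (verit) complex_mod_cnj norm_triangle_ineq)
          qed simp
          finally show ?thesis by (simp add: mult.commute)
        qed
        have "norm (f a - f b) \<le> (\<Sum>k\<in>UNIV. norm ((f a - f b) $ k))"
          unfolding norm_vec_def by (rule L2_set_le_sum) simp
        also have "\<dots> \<le> (\<Sum>k\<in>(UNIV :: 'n set). 4 * R * poincare_dist a b)"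
          by (rule sum_mono) (rule comp)
        finally show ?thesis by (simp add: dist_norm mult.assoc)
      qed
      from chain_length_ge_dist[OF that, of "\<lambda>x. x", OF this] show ?thesis by (simp add: dist_norm)
    qed
  qed (use R in simp)
qed

locale C1_convex_complex_domain = C1_convex_domain \<Omega> U \<rho>
  for \<Omega> U :: "(complex ^ 'n) set" and \<rho> :: "complex ^ 'n \<Rightarrow> real"
begin

text \<open>A complex affine function whose real part is the height above the real tangent
  hyperplane at \<xi>; its zero set is the complex tangent space moved to \<xi>.\<close>

abbreviation support :: "complex ^ 'n \<Rightarrow> complex ^ 'n \<Rightarrow> complex" where
  "support \<xi> x \<equiv> cinner (x - \<xi>) (normal \<xi>)"

lemma chain_exists:
  assumes "z \<in> \<Omega>" "w \<in> \<Omega>"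
  obtains S where "chain_length \<Omega> z w S"
proof -
  define b where "b = min (bdist z) (bdist w)"
  have b: "0 < b" using bdist_pos assms by (simp add: b_def)
  have balls: "ball z b \<subseteq> \<Omega>" "ball w b \<subseteq> \<Omega>"
    using ball_bdist_subset assms unfolding b_def by (metis min.cobounded1 min.cobounded2 order_trans subset_ball)+
  obtain n where "2 * norm (w - z) / b \<le> real n" using real_arch_simple by blast
  then have "norm (w - z) \<le> real (Suc n) * b / 2" using b by (simp add: field_simps)
  then show ?thesis
    using chain_length_convex[OF convex_dom balls b, of "Suc n"] that by auto
qed

lemma bounded_kobayashi_dist:
  assumes "0 < b"
  obtains M where "\<And>z w. ball z b \<subseteq> \<Omega> \<Longrightarrow> ball w b \<subseteq> \<Omega> \<Longrightarrow> kobayashi_dist \<Omega> z w \<le> M"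
proof -
  obtain n where n: "2 * diameter \<Omega> / b \<le> real n" using real_arch_simple by blast
  have "kobayashi_dist \<Omega> z w \<le> real (Suc n) * artanh (1 / 2)"
    if z: "ball z b \<subseteq> \<Omega>" and w: "ball w b \<subseteq> \<Omega>" for z w
  proof -
    have "z \<in> \<Omega>" "w \<in> \<Omega>" using z w assms by auto
    then have "norm (w - z) \<le> diameter \<Omega>"
      using diameter_bounded_bound[OF bounded_dom] by (simp add: dist_norm)
    also have "\<dots> \<le> real (Suc n) * b / 2" using n assms by (simp add: field_simps)
    finally show ?thesis
      using chain_length_convex[OF convex_dom z w assms, of "Suc n"] kobayashi_dist_le
      by fastforce
  qed
  then show ?thesis using that by blast
qed

lemma Re_support_pos: "\<xi> \<in> frontier \<Omega> \<Longrightarrow> x \<in> \<Omega> \<Longrightarrow> 0 < Re (support \<xi> x)"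
  using normal_inner_pos by (simp add: Re_cinner inner_commute)

lemma chain_length_ge_ln_support:
  assumes "chain_length \<Omega> z w S" "\<xi> \<in> frontier \<Omega>"
  shows "\<bar>ln (norm (support \<xi> z)) - ln (norm (support \<xi> w))\<bar> \<le> 2 * S"
proof -
  have "dist (ln (norm (support \<xi> (f a)))) (ln (norm (support \<xi> (f b)))) \<le> 2 * poincare_dist a b"
    if f: "holomorphic_disc f \<Omega>" and ab: "norm a < 1" "norm b < 1" for f a b
  proof -
    have "(\<lambda>\<zeta>. support \<xi> (f \<zeta>)) holomorphic_on ball 0 1"
      unfolding cinner_def using f
      by (auto simp: holomorphic_disc_def intro!: holomorphic_intros)
    moreover have "0 < Re (support \<xi> (f \<zeta>))" if "\<zeta> \<in> ball 0 1" for \<zeta>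
      using f that Re_support_pos[OF assms(2)] unfolding holomorphic_disc_def by blast
    ultimately show ?thesis
      using ln_quotient_le_poincare_dist[of "\<lambda>\<zeta>. support \<xi> (f \<zeta>)"] ab by (simp add: dist_real_def)
  qed
  from chain_length_ge_dist[OF assms(1), of "\<lambda>x. ln (norm (support \<xi> x))", OF this]
  show ?thesis by (simp add: dist_real_def)
qed

lemma kobayashi_dist_ge_ln_support:
  assumes "z \<in> \<Omega>" "w \<in> \<Omega>" "\<xi> \<in> frontier \<Omega>"
  shows "\<bar>ln (norm (support \<xi> z)) - ln (norm (support \<xi> w))\<bar> \<le> 2 * kobayashi_dist \<Omega> z w"
proof -
  obtain T where T: "chain_length \<Omega> z w T" using chain_exists assms by blast
  have "\<bar>ln (norm (support \<xi> z)) - ln (norm (support \<xi> w))\<bar> / 2 \<le> kobayashi_dist \<Omega> z w"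
    by (rule le_kobayashi_dist[OF T]) (use chain_length_ge_ln_support[OF _ assms(3)] in force)
  then show ?thesis by simp
qed

lemma support_on_normal:
  assumes "\<xi> \<in> frontier \<Omega>" "0 \<le> t"
  shows "norm (support \<xi> (\<xi> + t *\<^sub>R normal \<xi>)) = t"
  using norm_normal[OF assms(1)] assms(2) by (simp add: cinner_scaleR_left cinner_self)

text \<open>At the boundary point nearest to \<open>z\<close> the support function has modulus
  \<open>bdist z\<close>, while at \<open>o'\<close> it is at least \<open>bdist o'\<close> for
  every boundary point; hence a constant independent of \<open>z\<close>.\<close>

lemma kobayashi_dist_ge_ln_bdist:
  assumes o: "o' \<in> \<Omega>"
  obtains C where "\<And>z. z \<in> \<Omega> \<Longrightarrow> - ln (bdist z) / 2 - C \<le> kobayashi_dist \<Omega> o' z"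
proof (rule that)
  fix z assume z: "z \<in> \<Omega>"
  obtain \<xi> where \<xi>: "\<xi> \<in> frontier \<Omega>" "z = \<xi> + bdist z *\<^sub>R normal \<xi>"
    using bdist_attained[OF z] by blast
  have nz: "norm (support \<xi> z) = bdist z"
    using support_on_normal[OF \<xi>(1), of "bdist z"] \<xi>(2) infdist_nonneg by metis
  have "bdist o' \<le> Re (support \<xi> o')"
    using normal_inner_ge[OF \<xi>(1) bdist_pos[OF o] ball_bdist_subset[OF o]]
    by (simp add: Re_cinner inner_commute)
  also have "\<dots> \<le> norm (support \<xi> o')" by (rule complex_Re_le_cmod)
  finally have "ln (bdist o') \<le> ln (norm (support \<xi> o'))" using bdist_pos[OF o] by (intro ln_mono) auto
  then show "- ln (bdist z) / 2 - (- ln (bdist o') / 2) \<le> kobayashi_dist \<Omega> o' z"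
    using kobayashi_dist_ge_ln_support[OF o z \<xi>(1)] unfolding nz by simp
qed

section \<open>Consequences of complex strict convexity\<close>

lemma continuous_on_support: "continuous_on S (support \<xi>)"
  unfolding cinner_def by (intro continuous_intros)

text \<open>The real part of the equation puts \<open>x - \<xi>\<close> into the real tangent space,
  the imaginary part does so for its product with -i. The real part alone could also vanish along a
  real segment in the boundary, which is why moduli of support functions are used.\<close>

lemma support_eq_0_imp_eq:
  assumes "C_strictly_convex \<Omega>" "\<xi> \<in> frontier \<Omega>" "x \<in> closure \<Omega>" "support \<xi> x = 0"
  shows "x = \<xi>"
proof -
  have tangent: "v \<in> real_tangent_space \<Omega> \<xi>" if "Re (cinner v (normal \<xi>)) = 0" for v
  proof -
    obtain G where "\<And>v. frechet_derivative \<rho> (at \<xi>) v = - G * (normal \<xi> \<bullet> v)"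
      using derivative_eq_normal[OF assms(2)] by blast
    then show ?thesis
      using that real_tangent_space_eq[OF defining assms(2)] by (simp add: Re_cinner inner_commute)
  qed
  have "x - \<xi> \<in> real_tangent_space \<Omega> \<xi>" using tangent assms(4) by simp
  moreover have "(- \<i>) *s (x - \<xi>) \<in> real_tangent_space \<Omega> \<xi>"
    using assms(4) by (intro tangent) (simp only: cinner_scale_left, simp)
  moreover have "x - \<xi> = \<i> *s ((- \<i>) *s (x - \<xi>))" by (simp add: vec_eq_iff)
  ultimately have "x - \<xi> \<in> complex_tangent_space \<Omega> \<xi>"
    unfolding complex_tangent_space_def by blast
  then have "\<xi> + (x - \<xi>) \<in> (+) \<xi> ` complex_tangent_space \<Omega> \<xi>" by blast
  then have "x \<in> (+) \<xi> ` complex_tangent_space \<Omega> \<xi> \<inter> closure \<Omega>" using assms(3) by simp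
  then show ?thesis using assms(1,2) unfolding C_strictly_convex_def by blast
qed

text \<open>Makes \<open>support_eq_0_imp_eq\<close> uniform: a positive continuous function on the
  compact set of pairs at distance at least \<open>s\<close> has a positive minimum. Continuity in
  \<xi> is that of the normal.\<close>

lemma support_bounded_below:
  assumes sc: "C_strictly_convex \<Omega>" and s: "0 < s"
  obtains e where "0 < e"
    "\<And>\<xi> x. \<xi> \<in> frontier \<Omega> \<Longrightarrow> x \<in> closure \<Omega> \<Longrightarrow> s \<le> dist \<xi> x \<Longrightarrow> e \<le> norm (support \<xi> x)"
proof -
  define K where "K = (frontier \<Omega> \<times> closure \<Omega>) \<inter> {p. s \<le> dist (fst p) (snd p)}"
  have "compact (frontier \<Omega> \<times> closure \<Omega>)"
    using compact_frontier_dom bounded_dom by (intro compact_Times) (auto simp: compact_closure)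
  moreover have "closed {p :: (complex ^ 'n) \<times> (complex ^ 'n). s \<le> dist (fst p) (snd p)}"
    by (intro closed_Collect_le continuous_intros)
  ultimately have K: "compact K" unfolding K_def by blast
  have "continuous_on K (\<lambda>p. normal (fst p))"
    by (rule continuous_on_compose2[OF continuous_on_normal])
      (auto simp: K_def intro!: continuous_intros)
  then have cont: "continuous_on K (\<lambda>p. norm (support (fst p) (snd p)))"
    unfolding cinner_def by (intro continuous_intros)
  have pos: "0 < norm (support (fst p) (snd p))" if "p \<in> K" for p
    using support_eq_0_imp_eq[OF sc, of "fst p" "snd p"] that s by (auto simp: K_def)
  show ?thesis
  proof (cases "K = {}")
    case True
    then show ?thesis using that[of 1] by (force simp: K_def)
  next
    case False
    then obtain p where p: "p \<in> K"
      "\<And>q. q \<in> K \<Longrightarrow> norm (support (fst p) (snd p)) \<le> norm (support (fst q) (snd q))"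
      using continuous_attains_inf[OF K _ cont] by blast
    show ?thesis
    proof (rule that[OF pos[OF p(1)]])
      fix \<xi> x assume "\<xi> \<in> frontier \<Omega>" "x \<in> closure \<Omega>" "s \<le> dist \<xi> x"
      then show "norm (support (fst p) (snd p)) \<le> norm (support \<xi> x)"
        using p(2)[of "(\<xi>, x)"] by (simp add: K_def)
    qed
  qed
qed

text \<open>A chain from \<open>z\<close> to \<open>w\<close> has to leave the region where the support function at the boundary
  point below \<open>z\<close> is small, which by strict convexity lies near that point. Cutting the chain
  there, each part has a logarithmic lower bound, so that the two bounds add up.\<close>

lemma kobayashi_dist_two_point:
  assumes sc: "C_strictly_convex \<Omega>" and s: "0 < s"
  obtains e C where "0 < e"
    "\<And>z w. z \<in> \<Omega> \<Longrightarrow> w \<in> \<Omega> \<Longrightarrow> s \<le> dist z w \<Longrightarrow> bdist z < e \<Longrightarrow> bdist w < e \<Longrightarrow>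
       - ln (bdist z) / 2 - ln (bdist w) / 2 - C \<le> kobayashi_dist \<Omega> z w"
proof -
  obtain e where e: "0 < e" and sep:
    "\<And>\<xi> x. \<xi> \<in> frontier \<Omega> \<Longrightarrow> x \<in> closure \<Omega> \<Longrightarrow> s / 4 \<le> dist \<xi> x \<Longrightarrow> e \<le> norm (support \<xi> x)"
    using support_bounded_below[OF sc, of "s / 4"] s by auto
  show ?thesis
  proof (rule that[of "min (e / 2) (s / 4)" "- ln (e / 2) / 2 - ln e / 2"])
    fix z w
    assume z: "z \<in> \<Omega>" and w: "w \<in> \<Omega>" and zw: "s \<le> dist z w"
      and dz: "bdist z < min (e / 2) (s / 4)" and dw: "bdist w < min (e / 2) (s / 4)"
    obtain \<xi> where \<xi>: "\<xi> \<in> frontier \<Omega>" "z = \<xi> + bdist z *\<^sub>R normal \<xi>"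
      using bdist_attained[OF z] by blast
    obtain \<eta> where \<eta>: "\<eta> \<in> frontier \<Omega>" "w = \<eta> + bdist w *\<^sub>R normal \<eta>"
      using bdist_attained[OF w] by blast
    have nz: "norm (support \<xi> z) = bdist z"
      using support_on_normal[OF \<xi>(1), of "bdist z"] \<xi>(2) infdist_nonneg by metis
    have nw: "norm (support \<eta> w) = bdist w"
      using support_on_normal[OF \<eta>(1), of "bdist w"] \<eta>(2) infdist_nonneg by metis
    have d\<xi>: "dist z \<xi> = bdist z"
      using \<xi> norm_normal[OF \<xi>(1)] infdist_nonneg[of z "frontier \<Omega>"]
      by (metis abs_of_nonneg add_diff_cancel_left' dist_norm mult.right_neutral norm_scaleR)
    have d\<eta>: "dist w \<eta> = bdist w"
      using \<eta> norm_normal[OF \<eta>(1)] infdist_nonneg[of w "frontier \<Omega>"]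
      by (metis abs_of_nonneg add_diff_cancel_left' dist_norm mult.right_neutral norm_scaleR)
    have "dist z w \<le> dist z \<xi> + dist \<xi> w" by (rule dist_triangle)
    then have "s / 4 \<le> dist \<xi> w" using zw dz d\<xi> s by simp
    then have fw: "e \<le> norm (support \<xi> w)" using sep[OF \<xi>(1)] w closure_subset by blast
    obtain T where T: "chain_length \<Omega> z w T" using chain_exists[OF z w] by blast
    show "- ln (bdist z) / 2 - ln (bdist w) / 2 - (- ln (e / 2) / 2 - ln e / 2)
        \<le> kobayashi_dist \<Omega> z w"
    proof (rule le_kobayashi_dist[OF T])
      fix S assume S: "chain_length \<Omega> z w S"
      \<comment> \<open>The level \<open>e / 2\<close> is below the threshold \<open>e\<close>, so
        \<open>x\<close> is close to \<xi> and must be far from \<eta>, yet it is large enough to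
        pick up the logarithm of \<open>bdist z\<close>.\<close>
      obtain x S1 S2 where x: "norm (support \<xi> x) = e / 2" "chain_length \<Omega> z x S1"
        "chain_length \<Omega> x w S2" "S1 + S2 = S"
        using chain_cut[OF S, of "\<lambda>x. norm (support \<xi> x)" "e / 2"] nz dz fw e
          continuous_on_norm[OF continuous_on_support] by auto
      have xc: "x \<in> closure \<Omega>" using chain_length_in[OF x(2)] closure_subset by blast
      have "\<not> e \<le> norm (support \<xi> x)" using x(1) e by simp
      then have "dist \<xi> x < s / 4" using sep[OF \<xi>(1) xc] by (meson not_less)
      \<comment> \<open>Of the four legs all but the one between \<open>x\<close> and \<eta> are
        shorter than \<open>s / 4\<close>.\<close>
      moreover have "dist z w \<le> dist z \<xi> + (dist \<xi> x + (dist x \<eta> + dist \<eta> w))"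
        by (meson add_left_mono dist_triangle order_trans)
      ultimately have "s / 4 \<le> dist \<eta> x"
        using zw dz dw d\<xi> d\<eta> by (simp add: dist_commute)
      then have "e \<le> norm (support \<eta> x)" using sep[OF \<eta>(1) xc] by blast
      then have "ln e \<le> ln (norm (support \<eta> x))" using e by (intro ln_mono)
      moreover have "ln (norm (support \<eta> x)) - ln (bdist w) \<le> 2 * S2"
        using chain_length_ge_ln_support[OF x(3) \<eta>(1)] nw by simp
      moreover have "ln (e / 2) - ln (bdist z) \<le> 2 * S1"
        using chain_length_ge_ln_support[OF x(2) \<xi>(1)] nz x(1) by simp
      ultimately show "- ln (bdist z) / 2 - ln (bdist w) / 2 - (- ln (e / 2) / 2 - ln e / 2) \<le> S"
        using x(4) by linarith
    qed
  qed (use e s in simp)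
qed

end

subsection \<open>A disc in a domain with Dini-smooth boundary\<close>

text \<open>A lower sum for the integral over dyadic intervals: on \<open>{a N..<2 * a N}\<close>,
  of length \<open>a N\<close>, the integrand is at least \<open>\<omega> (a N) / (2 * a N)\<close>
  by monotonicity. For \<open>N = 0\<close> this interval ends at \<open>2 * r\<close>, so the
  induction starts from an empty range.\<close>

lemma dini_summable:
  fixes \<omega> :: "real \<Rightarrow> real"
  assumes dini: "dini_condition (2 * r) \<omega>" and mono: "mono_on {0..<2 * r} \<omega>"
  shows "summable (\<lambda>k. \<omega> (r / 2 ^ k))"
proof -
  have r: "0 < r" and nonneg: "\<And>t. t \<in> {0..<2 * r} \<Longrightarrow> 0 \<le> \<omega> t"
    and meas: "\<omega> \<in> borel_measurable (lebesgue_on {0..<2 * r})"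
    using dini by (auto simp: dini_condition_def)
  define M where "M = lebesgue_on {0..<2 * r}"
  define g where "g t = ennreal (\<omega> t / t)" for t
  have fin: "(\<integral>\<^sup>+ t. g t \<partial>M) < \<infinity>" using dini by (simp add: dini_condition_def M_def g_def)
  have id: "(\<lambda>t. t) \<in> borel_measurable M" unfolding M_def
    by (intro measurable_restrict_space1 measurable_completion) simp
  have g_meas: "g \<in> borel_measurable M"
    using meas id unfolding g_def M_def[symmetric] by (intro measurable_compose[OF _ measurable_ennreal]
        borel_measurable_divide)
  have sets: "{a..<b} \<in> sets M" if "0 \<le> a" "b \<le> 2 * r" for a b
    using that unfolding M_def by (auto simp: sets_restrict_space_iff)
  define a where "a k = r / 2 ^ k" for k :: nat
  have a: "0 < a k" "a k \<le> r" "2 * a (Suc k) = a k" for k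
    using r by (auto simp: a_def field_simps)
  have le: "(\<Sum>k<N. ennreal (\<omega> (a k) / 2)) \<le> (\<integral>\<^sup>+ t. g t * indicator {2 * a N..<2 * r} t \<partial>M)" for N
  proof (induction N)
    case (Suc N)
    let ?A = "{a N..<2 * a N}" and ?c = "ennreal (\<omega> (a N) / (2 * a N))"
    have A: "?A \<in> sets M" using a[of N] by (intro sets) auto
    have "emeasure M ?A = ennreal (a N)"
      unfolding M_def using a[of N] by (subst emeasure_restrict_space) auto
    then have "(\<integral>\<^sup>+ t. ?c * indicator ?A t \<partial>M) = ?c * ennreal (a N)"
      using A by (simp add: nn_integral_cmult_indicator)
    also have "\<dots> = ennreal (\<omega> (a N) / 2)"
      using a[of N] nonneg[of "a N"] by (simp add: ennreal_mult'[symmetric])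
    finally have "(\<Sum>k<Suc N. ennreal (\<omega> (a k) / 2))
        \<le> (\<integral>\<^sup>+ t. g t * indicator {2 * a N..<2 * r} t \<partial>M) + (\<integral>\<^sup>+ t. ?c * indicator ?A t \<partial>M)"
      using Suc.IH by (simp add: add_right_mono)
    also have "\<dots> = (\<integral>\<^sup>+ t. g t * indicator {2 * a N..<2 * r} t + ?c * indicator ?A t \<partial>M)"
      using A g_meas a[of N] sets[of "2 * a N" "2 * r"]
      by (intro nn_integral_add[symmetric] borel_measurable_times_ennreal
          borel_measurable_indicator borel_measurable_const) auto
    also have "\<dots> \<le> (\<integral>\<^sup>+ t. g t * indicator {2 * a (Suc N)..<2 * r} t \<partial>M)"
    proof (rule nn_integral_mono)
      fix t
      have "?c \<le> g t" if t: "t \<in> ?A"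
      proof -
        have "\<omega> (a N) \<le> \<omega> t" using mono_onD[OF mono, of "a N" t] t a[of N] by auto
        then show ?thesis unfolding g_def
          using t a[of N] nonneg[of "a N"] by (intro ennreal_leI frac_le) auto
      qed
      then show "g t * indicator {2 * a N..<2 * r} t + ?c * indicator ?A t
          \<le> g t * indicator {2 * a (Suc N)..<2 * r} t"
        unfolding a(3) using a[of N] by (auto simp: indicator_def)
    qed
    finally show ?case .
  qed simp
  define I where "I = enn2real (\<integral>\<^sup>+ t. g t \<partial>M)"
  have bound: "(\<Sum>k<N. \<omega> (a k)) \<le> 2 * I" for N
  proof -
    have nn: "0 \<le> \<omega> (a k) / 2" for k using nonneg[of "a k"] a[of k] r by auto
    have "ennreal (\<Sum>k<N. \<omega> (a k) / 2) = (\<Sum>k<N. ennreal (\<omega> (a k) / 2))"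
      using nn by (simp add: sum_ennreal)
    also have "\<dots> \<le> (\<integral>\<^sup>+ t. g t * indicator {2 * a N..<2 * r} t \<partial>M)" by (rule le)
    also have "\<dots> \<le> (\<integral>\<^sup>+ t. g t \<partial>M)" by (intro nn_integral_mono) (simp add: indicator_def)
    also have "\<dots> = ennreal I" using fin by (simp add: I_def)
    finally have "(\<Sum>k<N. \<omega> (a k) / 2) \<le> I"
      by (subst (asm) ennreal_le_iff) (auto simp: I_def)
    then show ?thesis by (simp add: sum_divide_distrib[symmetric])
  qed
  have "summable (\<lambda>k. \<omega> (a k))"
  proof (rule summableI_nonneg_bounded[where x = "2 * I"])
    show "0 \<le> \<omega> (a k)" for k using nonneg[of "a k"] a[of k] r by auto
  qed (rule bound)
  then show ?thesis by (simp add: a_def)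
qed

section \<open>A perturbed half-plane inside a Dini region\<close>

lemma norm_bump_le:
  assumes "0 < Re w" "0 < s"
  shows "norm (of_real s * w / (w + of_real s)) \<le> norm w"
proof -
  have "s \<le> norm (w + of_real s)" using complex_Re_le_cmod[of "w + of_real s"] assms by simp
  then show ?thesis
    using assms mult_right_mono[of s "norm (w + of_real s)" "norm w"]
    by (simp add: norm_mult norm_divide divide_le_eq mult.commute)
qed

text \<open>The expression is 1 / (1/w + 1/s), so it preserves the right half-plane, resembles
  \<open>w\<close> far below the scale \<open>s\<close> and tends to \<open>s\<close> far above
  it.\<close>

lemma Re_bump:
  assumes "0 < Re w" "0 < s"
  shows "Re (of_real s * w / (w + of_real s))
    = s * ((norm w)\<^sup>2 + s * Re w) / (norm (w + of_real s))\<^sup>2"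
  by (simp only: Re_divide cmod_power2) (simp add: power2_eq_square algebra_simps)

lemma Re_bump_nonneg:
  assumes "0 < Re w" "0 < s"
  shows "0 \<le> Re (of_real s * w / (w + of_real s))"
  unfolding Re_bump[OF assms] using assms by simp

lemma Re_bump_ge:
  assumes "0 < Re w" "0 < s" "s \<le> norm w"
  shows "s / 4 \<le> Re (of_real s * w / (w + of_real s))"
proof -
  have "norm (w + of_real s) \<le> 2 * norm w"
    using norm_triangle_ineq[of w "of_real s"] assms by simp
  then have "(norm (w + of_real s))\<^sup>2 \<le> (2 * norm w)\<^sup>2" by (intro power_mono) auto
  then have "(norm (w + of_real s))\<^sup>2 \<le> 4 * ((norm w)\<^sup>2 + s * Re w)"
    using assms by (simp add: power_mult_distrib add_increasing2)
  then have "s * (norm (w + of_real s))\<^sup>2 \<le> s * (4 * ((norm w)\<^sup>2 + s * Re w))"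
    using assms(2) by (intro mult_left_mono) auto
  moreover have "0 < (norm (w + of_real s))\<^sup>2"
    using complex_Re_le_cmod[of "w + of_real s"] assms by (simp add: complex_eq_iff)
  ultimately show ?thesis
    unfolding Re_bump[OF assms(1,2)] by (simp add: pos_le_divide_eq algebra_simps)
qed

text \<open>On the real diameter, \<open>u\<close> and \<open>v\<close> are the distances to the
  boundary point -1. The distance is exactly half the logarithm of
  \<open>(v * (2 - u)) / (u * (2 - v))\<close>; the factor 2 comes from 2 - u \<le> 2 and 2 - v
  \<ge> 1.\<close>

lemma poincare_dist_real_le:
  assumes "0 < u" "u \<le> v" "v \<le> (1::real)"
  shows "poincare_dist (of_real (v - 1)) (of_real (u - 1)) \<le> ln (2 * v / u) / 2"
proof -
  have uv: "u * v \<le> u" using assms by (simp add: mult_left_le)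
  define q where "q = u + v - u * v"
  define m where "m = (v - u) / q"
  have q: "0 < q" using assms uv unfolding q_def by linarith
  have m0: "0 \<le> m" using assms q by (simp add: m_def)
  have one: "(1::complex) - cnj (of_real (u - 1)) * of_real (v - 1) = of_real q"
    by (simp add: q_def algebra_simps)
  have "of_real (v - 1) - of_real (u - 1) = (of_real (v - u) :: complex)" by simp
  then have "norm ((of_real (v - 1) - of_real (u - 1)) /
      (1 - cnj (of_real (u - 1)) * of_real (v - 1) :: complex)) = m"
    unfolding one m_def using q assms by (simp only: norm_divide norm_of_real)
  then have p: "poincare_dist (of_real (v - 1)) (of_real (u - 1)) = ln ((1 + m) / (1 - m)) / 2"
    by (simp add: poincare_dist_def artanh_def)
  have "1 + m = v * (2 - u) / q" "1 - m = u * (2 - v) / q"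
    using q by (auto simp: m_def q_def field_simps)
  then have eq: "(1 + m) / (1 - m) = (v * (2 - u)) / (u * (2 - v))" using q by simp
  have "v * (2 - u) \<le> 2 * v" "u \<le> u * (2 - v)"
    using assms by (simp_all add: algebra_simps mult_left_le)
  then have "(v * (2 - u)) / (u * (2 - v)) \<le> 2 * v / u"
    using assms by (intro frac_le) auto
  moreover have "0 < (v * (2 - u)) / (u * (2 - v))" using assms by simp
  ultimately show ?thesis unfolding p eq by (simp add: ln_mono)
qed

text \<open>The half-plane is mapped into the region by a perturbation of the identity. The summand
  \<open>s w / (w + s)\<close> has modulus at most \<open>\<bar>w\<bar>\<close> and nonnegative real part, which is at least \<open>s / 4\<close>
  if \<open>\<bar>w\<bar> \<ge> s\<close>: with \<open>s = \<sigma> / 2 ^ k\<close> and weights proportional to \<open>\<omega>\<close> at the same scale, the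
  summand of the scale of \<open>w\<close> alone pushes \<open>w\<close> into the region, and the Dini condition makes the
  sum of the weights small.\<close>

lemma disc_in_Dini_region:
  fixes \<omega> :: "real \<Rightarrow> real"
  assumes r: "0 < r" and \<kappa>: "0 < \<kappa>" and e: "0 < e"
    and nonneg: "\<And>t. t \<in> {0..<2 * r} \<Longrightarrow> 0 \<le> \<omega> t" and mono: "mono_on {0..<2 * r} \<omega>"
    and sum: "summable (\<lambda>k. \<omega> (r / 2 ^ k))"
  obtains t0 where "0 < t0"
    "\<And>d t. 0 < d \<Longrightarrow> d \<le> t \<Longrightarrow> t \<le> t0 \<Longrightarrow>
       \<exists>\<Phi> a b. \<Phi> holomorphic_on ball 0 1 \<and>
         (\<forall>\<zeta>\<in>ball 0 1. norm (\<Phi> \<zeta>) < e \<and>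
            \<kappa> * norm (\<Phi> \<zeta>) * \<omega> (norm (\<Phi> \<zeta>)) < Re (\<Phi> \<zeta>)) \<and>
         norm a < 1 \<and> norm b < 1 \<and> \<Phi> a = of_real d \<and> \<Phi> b = of_real t \<and>
         poincare_dist a b \<le> ln (8 * t / d) / 2"
proof -
  have sum': "summable (\<lambda>k. 16 * \<kappa> * \<omega> (r / 2 ^ k))" using sum by (rule summable_mult)
  \<comment> \<open>Discarding the \<open>K1\<close> coarsest scales makes the weights sum to at
    most 1; discarding \<open>K2\<close> of them keeps the image within radius
    \<open>e\<close>.\<close>
  obtain K1 where K1: "\<And>n. K1 \<le> n \<Longrightarrow> norm (\<Sum>k. 16 * \<kappa> * \<omega> (r / 2 ^ (k + n))) < 1"
    using suminf_exist_split[OF _ sum', of 1] by auto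
  obtain K2 where K2: "r / e < 2 ^ K2" using real_arch_pow[of 2 "r / e"] by auto
  define K where "K = max K1 K2"
  \<comment> \<open>The 4 arranges that \<open>4 * s k\<close> is a point where \<omega> is sampled:
    if \<open>norm w < 2 * s k\<close>, the perturbed point has modulus at most
    \<open>4 * s k\<close>.\<close>
  define \<sigma> where "\<sigma> = r / 2 ^ K / 4"
  define s where "s k = \<sigma> / 2 ^ k" for k :: nat
  \<comment> \<open>With the factor 16, the gain \<open>c k * (s k / 4)\<close> is exactly
    \<open>\<kappa> * (4 * s k) * \<omega> (4 * s k)\<close>.\<close>
  define c where "c k = 16 * \<kappa> * \<omega> (r / 2 ^ (k + K))" for k
  have \<sigma>0: "0 < \<sigma>" using r by (simp add: \<sigma>_def)
  have s0: "0 < s k" for k using \<sigma>0 by (simp add: s_def)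
  have s_le: "s k \<le> \<sigma>" for k using \<sigma>0 by (simp add: s_def divide_le_eq mult_le_cancel_left1)
  have s4: "4 * s k = r / 2 ^ (k + K)" for k by (simp add: s_def \<sigma>_def power_add)
  have r_pow: "0 < r / 2 ^ n" "r / 2 ^ n \<le> r" for n :: nat
    using r by (auto simp: divide_le_eq mult_le_cancel_left1)
  have c0: "0 \<le> c k" for k
  proof -
    have "r / 2 ^ (k + K) \<in> {0..<2 * r}" using r_pow[of "k + K"] r by auto
    then show ?thesis unfolding c_def using nonneg \<kappa> by simp
  qed
  have c_sum: "(\<Sum>k\<in>A. c k) \<le> 1" if "finite A" for A
  proof -
    have "summable c" unfolding c_def by (rule summable_ignore_initial_segment[OF sum'])
    then have "(\<Sum>k\<in>A. c k) \<le> suminf c" using c0 that by (intro sum_le_suminf) auto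
    also have "\<dots> \<le> norm (suminf c)" by simp
    also have "\<dots> \<le> 1" using K1[of K] unfolding c_def K_def by simp
    finally show ?thesis .
  qed
  have "r / e < 2 ^ K" using K2 by (rule less_le_trans) (simp add: K_def)
  then have \<sigma>e: "4 * \<sigma> < e" using e by (simp add: \<sigma>_def field_simps)
  \<comment> \<open>The disc of radius \<open>R\<close> about \<open>s N + R\<close> will be
    perturbed; it lies in real part above \<open>s N\<close> and modulus below
    \<open>2 * \<sigma>\<close>.\<close>
  define R where "R = \<sigma> / 2"
  have R0: "0 < R" using \<sigma>0 by (simp add: R_def)
  show ?thesis
  proof (rule that[OF R0])
    fix d t :: real assume d: "0 < d" "d \<le> t" and t: "t \<le> R"
    \<comment> \<open>The disc stays away from scales below \<open>s N\<close>, so a finite sum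
      suffices, depending on \<open>d\<close>; its weights are still bounded independently of
      \<open>N\<close>.\<close>
    obtain N where N: "4 * \<sigma> / d < 2 ^ N" using real_arch_pow[of 2 "4 * \<sigma> / d"] by auto
    then have sN: "s N < d / 4" using d by (simp add: s_def field_simps)
    define \<phi> where "\<phi> w = w + (\<Sum>k\<le>N. of_real (c k) * (of_real (s k) * w / (w + of_real (s k))))"
      for w :: complex
    have \<phi>_norm: "norm (\<phi> w) \<le> 2 * norm w" if w: "0 < Re w" for w
    proof -
      have "norm (\<Sum>k\<le>N. of_real (c k) * (of_real (s k) * w / (w + of_real (s k))))
          \<le> (\<Sum>k\<le>N. c k * norm w)"
      proof (rule sum_norm_le)
        fix k
        have "norm (of_real (c k) * (of_real (s k) * w / (w + of_real (s k))))
            = c k * norm (of_real (s k) * w / (w + of_real (s k)))"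
          using c0[of k] by (subst norm_mult) simp
        also have "\<dots> \<le> c k * norm w" using norm_bump_le[OF w s0] c0 by (intro mult_left_mono)
        finally show "norm (of_real (c k) * (of_real (s k) * w / (w + of_real (s k))))
            \<le> c k * norm w" .
      qed
      also have "\<dots> \<le> 1 * norm w"
        using c_sum[of "{..N}"] unfolding sum_distrib_right[symmetric]
        by (intro mult_right_mono) auto
      finally show ?thesis unfolding \<phi>_def
        using norm_triangle_ineq[of w "\<Sum>k\<le>N. of_real (c k) * (of_real (s k) * w / (w + of_real (s k)))"]
        by simp
    qed
    have \<phi>_Re: "Re w + c k * (s k / 4) \<le> Re (\<phi> w)"
      if w: "0 < Re w" and k: "k \<le> N" "s k \<le> norm w" for w k
    proof -
      have Re: "Re (\<phi> w) = Re w + (\<Sum>k\<le>N. c k * Re (of_real (s k) * w / (w + of_real (s k))))"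
        unfolding \<phi>_def by (simp del: times_divide_eq_right times_divide_eq_left)
      have "c k * (s k / 4) \<le> c k * Re (of_real (s k) * w / (w + of_real (s k)))"
        using Re_bump_ge[OF w s0 k(2)] c0 by (intro mult_left_mono)
      also have "\<dots> \<le> (\<Sum>k\<le>N. c k * Re (of_real (s k) * w / (w + of_real (s k))))"
        using k(1) c0 Re_bump_nonneg[OF w s0]
        by (intro member_le_sum[of k]) (auto intro!: mult_nonneg_nonneg)
      finally show ?thesis unfolding Re by simp
    qed
    have \<phi>_region: "norm (\<phi> w) < e \<and> \<kappa> * norm (\<phi> w) * \<omega> (norm (\<phi> w)) < Re (\<phi> w)"
      if w: "0 < Re w" "s N \<le> norm w" "norm w < 2 * \<sigma>" for w
    proof -
      \<comment> \<open>The scale of \<open>w\<close>: minimality gives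
        \<open>s k \<le> norm w < 2 * s k\<close>.\<close>
      define k where "k = (LEAST k. s k \<le> norm w)"
      have k: "s k \<le> norm w" "k \<le> N"
        unfolding k_def using w(2) by (auto intro: LeastI Least_le)
      have up: "norm w < 2 * s k"
      proof (cases k)
        case 0
        then show ?thesis using w(3) by (simp add: s_def)
      next
        case (Suc j)
        then have "\<not> s j \<le> norm w" using not_less_Least[of j "\<lambda>k. s k \<le> norm w"] by (simp add: k_def)
        then show ?thesis by (simp add: Suc s_def)
      qed
      have n: "norm (\<phi> w) \<le> 2 * norm w" by (rule \<phi>_norm[OF w(1)])
      then have n4: "norm (\<phi> w) \<le> 4 * s k" using up by simp
      have "4 * s k < 2 * r" unfolding s4 using r_pow(2)[of "k + K"] r by simp
      then have mem: "norm (\<phi> w) \<in> {0..<2 * r}" "4 * s k \<in> {0..<2 * r}"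
        using n4 s0[of k] by (simp_all add: less_imp_le)
      then have "\<omega> (norm (\<phi> w)) \<le> \<omega> (4 * s k)" using mono_onD[OF mono] n4 by blast
      then have "norm (\<phi> w) * \<omega> (norm (\<phi> w)) \<le> (2 * norm w) * \<omega> (4 * s k)"
        using n nonneg[OF mem(1)] by (intro mult_mono) auto
      also have "\<dots> \<le> (4 * s k) * \<omega> (4 * s k)"
        using up nonneg[OF mem(2)] by (intro mult_right_mono) auto
      finally have "\<kappa> * (norm (\<phi> w) * \<omega> (norm (\<phi> w))) \<le> \<kappa> * ((4 * s k) * \<omega> (4 * s k))"
        using \<kappa> by (intro mult_left_mono) auto
      also have "\<dots> = c k * (s k / 4)" by (simp add: c_def s4[symmetric])
      also have "\<dots> < Re w + c k * (s k / 4)" using w(1) by simp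
      also have "\<dots> \<le> Re (\<phi> w)" by (rule \<phi>_Re[OF w(1) k(2,1)])
      finally have "\<kappa> * norm (\<phi> w) * \<omega> (norm (\<phi> w)) < Re (\<phi> w)" by (simp add: mult.assoc)
      moreover have "norm (\<phi> w) < e" using n w(3) \<sigma>e by simp
      ultimately show ?thesis by simp
    qed
    \<comment> \<open>On the positive axis the perturbation is real and lies between x and 2 x, so
      the intermediate value theorem yields preimages of \<open>d\<close> and
      \<open>t\<close>.\<close>
    define \<psi> where "\<psi> x = x + (\<Sum>k\<le>N. c k * (s k * x / (x + s k)))" for x :: real
    have \<psi>: "\<phi> (of_real x) = of_real (\<psi> x)" for x by (simp add: \<phi>_def \<psi>_def)
    have \<psi>_bounds: "x \<le> \<psi> x" "\<psi> x \<le> 2 * x" if x: "0 < x" for x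
    proof -
      show "x \<le> \<psi> x" unfolding \<psi>_def using x s0 c0
        by (simp add: sum_nonneg less_imp_le)
      have "norm (\<phi> (of_real x)) \<le> 2 * norm (of_real x :: complex)" using x by (intro \<phi>_norm) simp
      then show "\<psi> x \<le> 2 * x" unfolding \<psi> using x by simp
    qed
    have \<psi>_cont: "continuous_on {x..y} \<psi>" if "0 < x" for x y
    proof -
      have "z + s k \<noteq> 0" if "z \<in> {x..y}" for z k
        using that \<open>0 < x\<close> s0[of k] by auto
      then show ?thesis unfolding \<psi>_def by (intro continuous_intros) auto
    qed
    obtain w0 where w0: "d / 2 \<le> w0" "w0 \<le> d" "\<psi> w0 = d"
      using IVT'[of \<psi> "d / 2" d d] \<psi>_bounds[of "d / 2"] \<psi>_bounds[of d] \<psi>_cont[of "d / 2" d] d by auto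
    obtain w1 where w1: "w0 \<le> w1" "w1 \<le> t" "\<psi> w1 = t"
      using IVT'[of \<psi> w0 t t] \<psi>_bounds[of t] \<psi>_cont[of w0 t] d w0 by auto
    define \<Phi> where "\<Phi> \<zeta> = \<phi> (of_real (s N + R) + of_real R * \<zeta>)" for \<zeta>
    have arg: "s N < Re (of_real (s N + R) + of_real R * \<zeta>)"
      "norm (of_real (s N + R) + of_real R * \<zeta> :: complex) < 2 * \<sigma>" if "\<zeta> \<in> ball 0 1" for \<zeta>
    proof -
      have z: "norm \<zeta> < 1" using that by simp
      then have "- 1 < Re \<zeta>" using abs_Re_le_cmod[of \<zeta>] by linarith
      then have "R * (- 1) < R * Re \<zeta>" using R0 by (intro mult_strict_left_mono)
      then show "s N < Re (of_real (s N + R) + of_real R * \<zeta>)" by simp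
      have "norm (of_real (s N + R) + of_real R * \<zeta> :: complex)
          \<le> norm (of_real (s N + R) :: complex) + norm (of_real R * \<zeta>)" by (rule norm_triangle_ineq)
      also have "\<dots> = (s N + R) + R * norm \<zeta>" using s0[of N] R0 by (simp only: norm_mult norm_of_real)
      also have "\<dots> < (s N + R) + R * 1" using z R0 by simp
      also have "\<dots> \<le> 2 * \<sigma>" using s_le[of N] by (simp add: R_def)
      finally show "norm (of_real (s N + R) + of_real R * \<zeta> :: complex) < 2 * \<sigma>" .
    qed
    have hol: "\<Phi> holomorphic_on ball 0 1"
    proof -
      have "of_real (s N + R) + of_real R * \<zeta> + of_real (s k) \<noteq> (0::complex)" if "\<zeta> \<in> ball 0 1" for \<zeta> k
      proof -
        have "0 < Re (of_real (s N + R) + of_real R * \<zeta> + of_real (s k))"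
          using arg(1)[OF that] s0[of N] s0[of k] by simp
        then show ?thesis by (metis less_irrefl zero_complex.sel(1))
      qed
      then show ?thesis unfolding \<Phi>_def \<phi>_def by (intro holomorphic_intros) auto
    qed
    have region: "norm (\<Phi> \<zeta>) < e \<and> \<kappa> * norm (\<Phi> \<zeta>) * \<omega> (norm (\<Phi> \<zeta>)) < Re (\<Phi> \<zeta>)"
      if "\<zeta> \<in> ball 0 1" for \<zeta>
      unfolding \<Phi>_def
    proof (rule \<phi>_region)
      let ?w = "of_real (s N + R) + of_real R * \<zeta>"
      show "0 < Re ?w" using arg(1)[OF that] s0[of N] by simp
      show "s N \<le> norm ?w" using arg(1)[OF that] complex_Re_le_cmod[of ?w] by linarith
      show "norm ?w < 2 * \<sigma>" by (rule arg(2)[OF that])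
    qed
    \<comment> \<open>The points are \<open>s N + R * (1 + \<zeta>)\<close>, so \<open>w0\<close>
      and \<open>w1\<close> have the parameters \<open>u - 1\<close> and
      \<open>v - 1\<close>.\<close>
    define u where "u = (w0 - s N) / R"
    define v where "v = (w1 - s N) / R"
    \<comment> \<open>As \<open>w0 \<ge> d / 2\<close> and \<open>s N < d / 4\<close>, a factor 4 is
      lost; with the 2 of \<open>poincare_dist_real_le\<close> this makes the 8.\<close>
    have ud: "d / 4 \<le> u * R" "v * R \<le> t" using w0 w1 sN s0[of N] R0 by (auto simp: u_def v_def)
    have Rw: "R * u = w0 - s N" "R * v = w1 - s N" using R0 by (simp_all add: u_def v_def)
    have uv: "0 < u" "u \<le> v" "v \<le> 1"
    proof -
      have "d / 4 \<le> w0 - s N" using w0 sN by simp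
      then show "0 < u" using d R0 by (simp add: u_def)
      show "u \<le> v" using w1 R0 by (simp add: u_def v_def divide_right_mono)
      show "v \<le> 1" using w1 t s0[of N] R0 by (simp add: v_def)
    qed
    let ?a = "complex_of_real (u - 1)" and ?b = "complex_of_real (v - 1)"
    have "of_real (s N + R) + of_real R * ?a = complex_of_real (s N + R + R * (u - 1))" by simp
    also have "s N + R + R * (u - 1) = w0" using Rw by (simp add: right_diff_distrib)
    finally have a: "\<Phi> ?a = of_real d" using \<psi> w0(3) by (simp only: \<Phi>_def)
    have "of_real (s N + R) + of_real R * ?b = complex_of_real (s N + R + R * (v - 1))" by simp
    also have "s N + R + R * (v - 1) = w1" using Rw by (simp add: right_diff_distrib)
    finally have b: "\<Phi> ?b = of_real t" using \<psi> w1(3) by (simp only: \<Phi>_def)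
    have ab: "norm ?a < 1" "norm ?b < 1" using uv by (simp_all only: norm_of_real)
    have "poincare_dist ?a ?b \<le> ln (2 * v / u) / 2"
      using poincare_dist_real_le[OF uv] poincare_dist_commute by metis
    also have "2 * v / u = 2 * (v * R) / (u * R)" using R0 by simp
    also have "\<dots> \<le> 2 * t / (d / 4)" using ud d uv R0 by (intro frac_le mult_left_mono) auto
    then have "ln (2 * (v * R) / (u * R)) / 2 \<le> ln (8 * t / d) / 2"
      using uv R0 by (intro divide_right_mono ln_mono) (auto simp: mult.commute)
    finally have "poincare_dist ?a ?b \<le> ln (8 * t / d) / 2" .
    then show "\<exists>\<Phi> a b. \<Phi> holomorphic_on ball 0 1 \<and>
         (\<forall>\<zeta>\<in>ball 0 1. norm (\<Phi> \<zeta>) < e \<and>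
            \<kappa> * norm (\<Phi> \<zeta>) * \<omega> (norm (\<Phi> \<zeta>)) < Re (\<Phi> \<zeta>)) \<and>
         norm a < 1 \<and> norm b < 1 \<and> \<Phi> a = of_real d \<and> \<Phi> b = of_real t \<and>
         poincare_dist a b \<le> ln (8 * t / d) / 2"
      using hol region a b ab by blast
  qed
qed

subsection \<open>Upper bounds for the Kobayashi distance\<close>

locale Dini_convex_domain = C1_convex_complex_domain \<Omega> U \<rho>
  for \<Omega> U :: "(complex ^ 'n) set" and \<rho> :: "complex ^ 'n \<Rightarrow> real" +
  fixes r :: real and \<omega> :: "real \<Rightarrow> real"
  assumes r_pos: "0 < r" and ball_nbhd: "\<xi> \<in> frontier \<Omega> \<Longrightarrow> ball \<xi> r \<subseteq> U"
    and modulus: "\<xi> \<in> frontier \<Omega> \<Longrightarrow>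
      has_modulus_of_continuity (directional_derivative (\<i> *s inward_unit_normal \<Omega> \<xi>) \<rho>) \<xi> r \<omega>"
    and dini: "dini_condition (2 * r) \<omega>"
begin

lemma modulus_nonneg: "t \<in> {0..<2 * r} \<Longrightarrow> 0 \<le> \<omega> t"
  using dini by (simp add: dini_condition_def)

lemma modulus_mono: "mono_on {0..<2 * r} \<omega>"
  using modulus frontier_nonempty by (auto simp: has_modulus_of_continuity_def)

text \<open>With \<zeta> = x + iy, moving by x along the normal brings \<rho> to at most - 3 c x.
  Moving by y along i times the normal then raises it by at most |\<zeta>| \<omega>(|\<zeta>|): that
  derivative vanishes at \<xi>, so its modulus bounds it along the path. The choice of \<kappa>
  balances the two terms.\<close>

lemma Dini_region_subset:
  obtains \<kappa> e where "0 < \<kappa>" "0 < e"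
    "\<And>\<xi> \<zeta>. \<xi> \<in> frontier \<Omega> \<Longrightarrow> norm \<zeta> < e \<Longrightarrow> \<kappa> * norm \<zeta> * \<omega> (norm \<zeta>) < Re \<zeta> \<Longrightarrow>
       \<xi> + \<zeta> *s normal \<xi> \<in> \<Omega>"
proof -
  obtain c e1 where c: "0 < c" and e1: "0 < e1" and bound:
    "\<And>\<xi> u. \<xi> \<in> frontier \<Omega> \<Longrightarrow> norm u \<le> e1 \<Longrightarrow> 0 \<le> normal \<xi> \<bullet> u \<Longrightarrow>
       \<xi> + u \<in> U \<and> \<rho> (\<xi> + u) \<le> - 4 * c * (normal \<xi> \<bullet> u) + c * norm u"
    using defining_function_upper_bound by blast
  show ?thesis
  proof (rule that[of "1 / (3 * c)" "min e1 r"])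
    fix \<xi> \<zeta>
    assume \<xi>: "\<xi> \<in> frontier \<Omega>" and \<zeta>: "norm \<zeta> < min e1 r"
      and Re: "1 / (3 * c) * norm \<zeta> * \<omega> (norm \<zeta>) < Re \<zeta>"
    let ?\<eta> = "normal \<xi>" and ?\<omega> = "\<omega> (norm \<zeta>)"
    let ?dd = "directional_derivative (\<i> *s ?\<eta>) \<rho>"
    define x where "x = Re \<zeta>"
    define y where "y = Im \<zeta>"
    have \<omega>0: "0 \<le> ?\<omega>" using \<zeta> r_pos by (intro modulus_nonneg) auto
    then have "0 \<le> 1 / (3 * c) * norm \<zeta> * ?\<omega>" using c by simp
    then have x0: "0 < x" using Re by (simp add: x_def)
    have nn: "?\<eta> \<bullet> ?\<eta> = 1" using norm_normal[OF \<xi>] by (simp add: norm_eq_1)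
    have xz: "x \<le> norm \<zeta>" using complex_Re_le_cmod by (simp add: x_def)
    have u: "norm (x *\<^sub>R ?\<eta>) = x" using x0 norm_normal[OF \<xi>] by simp
    have "\<rho> (\<xi> + x *\<^sub>R ?\<eta>) \<le> - 4 * c * (?\<eta> \<bullet> (x *\<^sub>R ?\<eta>)) + c * norm (x *\<^sub>R ?\<eta>)"
      using bound[OF \<xi>, of "x *\<^sub>R ?\<eta>"] u nn x0 xz \<zeta> by simp
    then have normal_bound: "\<rho> (\<xi> + x *\<^sub>R ?\<eta>) \<le> - 3 * c * x" using u nn by simp
    define v where "v = y *\<^sub>R (\<i> *s ?\<eta>)"
    define p where "p t = \<xi> + x *\<^sub>R ?\<eta> + t *\<^sub>R v" for t :: real
    have p_eq: "p t = \<xi> + Complex x (t * y) *s ?\<eta>" for t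
      by (simp add: p_def v_def vec_eq_iff complex_eq_iff algebra_simps)
    have p_norm: "norm (p t - \<xi>) \<le> norm \<zeta>" if "0 \<le> t" "t \<le> 1" for t
    proof -
      have "(t * y)\<^sup>2 \<le> y\<^sup>2"
        using that by (simp add: power_mult_distrib mult_left_le_one_le power_le_one)
      then have "norm (Complex x (t * y)) \<le> norm \<zeta>"
        by (simp add: cmod_def x_def y_def)
      then show ?thesis
        unfolding p_eq by (simp add: norm_complex_scaleV norm_normal[OF \<xi>])
    qed
    then have p_ball: "p t \<in> ball \<xi> r" if "0 \<le> t" "t \<le> 1" for t
      using p_norm[OF that] \<zeta> by (simp add: dist_norm norm_minus_commute)
    have dd: "?dd q = frechet_derivative \<rho> (at q) (\<i> *s ?\<eta>)" if "q \<in> U" for q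
      unfolding directional_derivative_def
      using ray_derivative[OF defining_function_has_derivative[OF defining that]]
      by (rule DERIV_imp_deriv)
    have deriv: "((\<lambda>t. \<rho> (p t)) has_real_derivative y * ?dd (p t)) (at t)"
      if t: "0 \<le> t" "t \<le> 1" for t
    proof -
      have pU: "p t \<in> U" using p_ball[OF t] ball_nbhd[OF \<xi>] by blast
      let ?D = "frechet_derivative \<rho> (at (p t))"
      note D = defining_function_has_derivative[OF defining pU]
      have "((\<lambda>h. \<rho> (p t + h *\<^sub>R v)) has_real_derivative ?D v) (at 0)"
        by (rule ray_derivative[OF D])
      moreover have "p t + h *\<^sub>R v = p (h + t)" for h by (simp add: p_def algebra_simps)
      moreover have "?D v = y * ?dd (p t)"
        using has_derivative_linear[OF D] by (simp add: dd[OF pU] v_def linear_cmul)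
      ultimately have "((\<lambda>h. \<rho> (p (h + t))) has_real_derivative y * ?dd (p t)) (at 0)" by simp
      then show ?thesis using DERIV_shift[of "\<lambda>t. \<rho> (p t)" _ 0 t] by simp
    qed
    obtain t where t: "0 < t" "t < 1" "\<rho> (p 1) - \<rho> (p 0) = (1 - 0) * (y * ?dd (p t))"
      using MVT2[of 0 1 "\<lambda>t. \<rho> (p t)" "\<lambda>t. y * ?dd (p t)"] deriv by auto
    have "?dd \<xi> = 0"
    proof -
      obtain G where "\<And>v. frechet_derivative \<rho> (at \<xi>) v = - G * (?\<eta> \<bullet> v)"
        using derivative_eq_normal[OF \<xi>] by blast
      moreover have "?\<eta> \<bullet> (\<i> *s ?\<eta>) = 0"
        using Im_cinner[of ?\<eta> ?\<eta>] by (simp add: cinner_self)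
      ultimately show ?thesis using dd[of \<xi>] \<xi> frontier_subset_nbhd by auto
    qed
    moreover have "\<bar>?dd (p t) - ?dd \<xi>\<bar> \<le> \<omega> (norm (p t - \<xi>))"
      using modulus[OF \<xi>] p_ball[of t] t r_pos unfolding has_modulus_of_continuity_def by simp
    moreover have "\<omega> (norm (p t - \<xi>)) \<le> ?\<omega>"
      using p_norm[of t] t \<zeta> r_pos by (intro mono_onD[OF modulus_mono]) auto
    ultimately have "\<bar>?dd (p t)\<bar> \<le> ?\<omega>" by simp
    then have "\<bar>y\<bar> * \<bar>?dd (p t)\<bar> \<le> norm \<zeta> * ?\<omega>"
      using abs_Im_le_cmod[of \<zeta>] by (intro mult_mono) (auto simp: y_def)
    then have "y * ?dd (p t) \<le> norm \<zeta> * ?\<omega>" by (simp add: abs_mult[symmetric])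
    then have "\<rho> (p 1) \<le> - 3 * c * x + norm \<zeta> * ?\<omega>"
      using t(3) normal_bound by (simp add: p_def)
    also have "\<dots> < 0" using Re c by (simp add: x_def field_simps)
    finally have "p 1 \<in> \<Omega>" using mem_dom_iff_nbhd p_ball[of 1] ball_nbhd[OF \<xi>] by auto
    moreover have "Complex x y = \<zeta>" by (simp add: x_def y_def)
    ultimately show "\<xi> + \<zeta> *s ?\<eta> \<in> \<Omega>" unfolding p_eq by simp
  qed (use c e1 r_pos in auto)
qed

lemma kobayashi_dist_normal_le:
  obtains t0 where "0 < t0"
    "\<And>\<xi> d t. \<xi> \<in> frontier \<Omega> \<Longrightarrow> 0 < d \<Longrightarrow> d \<le> t \<Longrightarrow> t \<le> t0 \<Longrightarrow>
       kobayashi_dist \<Omega> (\<xi> + d *\<^sub>R normal \<xi>) (\<xi> + t *\<^sub>R normal \<xi>) \<le> ln (8 * t / d) / 2"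
proof -
  obtain \<kappa> e where \<kappa>: "0 < \<kappa>" and e: "0 < e" and region:
    "\<And>\<xi> \<zeta>. \<xi> \<in> frontier \<Omega> \<Longrightarrow> norm \<zeta> < e \<Longrightarrow> \<kappa> * norm \<zeta> * \<omega> (norm \<zeta>) < Re \<zeta> \<Longrightarrow>
       \<xi> + \<zeta> *s normal \<xi> \<in> \<Omega>"
    using Dini_region_subset by blast
  obtain t0 where t0: "0 < t0" and discs: "\<And>d t. 0 < d \<Longrightarrow> d \<le> t \<Longrightarrow> t \<le> t0 \<Longrightarrow>
       \<exists>\<Phi> a b. \<Phi> holomorphic_on ball 0 1 \<and>
         (\<forall>\<zeta>\<in>ball 0 1. norm (\<Phi> \<zeta>) < e \<and>
            \<kappa> * norm (\<Phi> \<zeta>) * \<omega> (norm (\<Phi> \<zeta>)) < Re (\<Phi> \<zeta>)) \<and>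
         norm a < 1 \<and> norm b < 1 \<and> \<Phi> a = of_real d \<and> \<Phi> b = of_real t \<and>
         poincare_dist a b \<le> ln (8 * t / d) / 2"
    using disc_in_Dini_region[OF r_pos \<kappa> e modulus_nonneg modulus_mono
        dini_summable[OF dini modulus_mono]] by blast
  show ?thesis
  proof (rule that[OF t0])
    fix \<xi> and d t :: real
    assume \<xi>: "\<xi> \<in> frontier \<Omega>" and dt: "0 < d" "d \<le> t" "t \<le> t0"
    obtain \<Phi> a b where \<Phi>: "\<Phi> holomorphic_on ball 0 1"
      "\<forall>\<zeta>\<in>ball 0 1. norm (\<Phi> \<zeta>) < e \<and> \<kappa> * norm (\<Phi> \<zeta>) * \<omega> (norm (\<Phi> \<zeta>)) < Re (\<Phi> \<zeta>)"
      "norm a < 1" "norm b < 1" "\<Phi> a = of_real d" "\<Phi> b = of_real t"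
      "poincare_dist a b \<le> ln (8 * t / d) / 2"
      using discs[OF dt] by blast
    have "holomorphic_disc (\<lambda>\<zeta>. \<xi> + \<Phi> \<zeta> *s normal \<xi>) \<Omega>"
      unfolding holomorphic_disc_def using \<Phi>(1,2) region[OF \<xi>]
      by (auto intro!: holomorphic_intros)
    from chain_length_disc[OF this \<Phi>(3,4)]
    have "chain_length \<Omega> (\<xi> + of_real d *s normal \<xi>) (\<xi> + of_real t *s normal \<xi>)
        (poincare_dist a b)" by (simp only: \<Phi>(5,6))
    moreover have "complex_of_real x *s v = x *\<^sub>R v" for x and v :: "complex ^ 'n"
      by (simp add: vec_eq_iff scaleR_conv_of_real[where 'a = complex])
    ultimately have "chain_length \<Omega> (\<xi> + d *\<^sub>R normal \<xi>) (\<xi> + t *\<^sub>R normal \<xi>)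
        (poincare_dist a b)" by simp
    then show "kobayashi_dist \<Omega> (\<xi> + d *\<^sub>R normal \<xi>) (\<xi> + t *\<^sub>R normal \<xi>) \<le> ln (8 * t / d) / 2"
      using kobayashi_dist_le \<Phi>(7) order_trans by blast
  qed
qed

lemma kobayashi_dist_triangle':
  assumes "x \<in> \<Omega>" "y \<in> \<Omega>" "z \<in> \<Omega>"
  shows "kobayashi_dist \<Omega> x z \<le> kobayashi_dist \<Omega> x y + kobayashi_dist \<Omega> y z"
  using assms chain_exists kobayashi_dist_triangle by metis

text \<open>\<open>z'\<close> lies at height \<open>t\<close> on the normal through \<open>z\<close>
  and the nearest boundary point.\<close>

lemma kobayashi_dist_push:
  obtains t0 where "0 < t0"
    "\<And>z t. z \<in> \<Omega> \<Longrightarrow> bdist z \<le> t \<Longrightarrow> t \<le> t0 \<Longrightarrow>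
       \<exists>z'. ball z' (t / 4) \<subseteq> \<Omega> \<and> dist z z' \<le> t \<and>
         kobayashi_dist \<Omega> z z' \<le> ln (8 * t / bdist z) / 2"
proof -
  obtain t1 where t1: "0 < t1"
    "\<And>\<xi> t. \<xi> \<in> frontier \<Omega> \<Longrightarrow> 0 < t \<Longrightarrow> t \<le> t1 \<Longrightarrow> ball (\<xi> + t *\<^sub>R normal \<xi>) (t / 4) \<subseteq> \<Omega>"
    using interior_ball_on_normal by blast
  obtain t2 where t2: "0 < t2"
    "\<And>\<xi> d t. \<xi> \<in> frontier \<Omega> \<Longrightarrow> 0 < d \<Longrightarrow> d \<le> t \<Longrightarrow> t \<le> t2 \<Longrightarrow>
       kobayashi_dist \<Omega> (\<xi> + d *\<^sub>R normal \<xi>) (\<xi> + t *\<^sub>R normal \<xi>) \<le> ln (8 * t / d) / 2"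
    using kobayashi_dist_normal_le by blast
  show ?thesis
  proof (rule that[of "min t1 t2"])
    fix z t assume z: "z \<in> \<Omega>" and t: "bdist z \<le> t" "t \<le> min t1 t2"
    have d: "0 < bdist z" by (rule bdist_pos[OF z])
    obtain \<xi> where \<xi>: "\<xi> \<in> frontier \<Omega>" "z = \<xi> + bdist z *\<^sub>R normal \<xi>"
      using bdist_attained[OF z] by blast
    let ?z = "\<xi> + t *\<^sub>R normal \<xi>"
    have "?z - z = (t - bdist z) *\<^sub>R normal \<xi>" by (subst \<xi>(2)) (simp add: algebra_simps)
    then have "dist z ?z = t - bdist z"
      using t norm_normal[OF \<xi>(1)] by (metis abs_of_nonneg diff_ge_0_iff_ge dist_commute dist_norm
          mult.right_neutral norm_scaleR)
    then have "dist z ?z \<le> t" using d by simp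
    moreover have "kobayashi_dist \<Omega> z ?z \<le> ln (8 * t / bdist z) / 2"
      using t2(2)[OF \<xi>(1) d t(1)] t(2) \<xi>(2) by simp
    moreover have "ball ?z (t / 4) \<subseteq> \<Omega>" using t1(2)[OF \<xi>(1)] t d by simp
    ultimately show "\<exists>z'. ball z' (t / 4) \<subseteq> \<Omega> \<and> dist z z' \<le> t \<and>
         kobayashi_dist \<Omega> z z' \<le> ln (8 * t / bdist z) / 2" by blast
  qed (use t1 t2 in auto)
qed

lemma kobayashi_dist_near_boundary_le:
  obtains t0 C where "0 < t0"
    "\<And>z w t. z \<in> \<Omega> \<Longrightarrow> w \<in> \<Omega> \<Longrightarrow> bdist z \<le> t \<Longrightarrow> bdist w \<le> t \<Longrightarrow> dist z w \<le> t \<Longrightarrow> t \<le> t0 \<Longrightarrow>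
       kobayashi_dist \<Omega> z w \<le> ln (8 * t) - ln (bdist z) / 2 - ln (bdist w) / 2 + C"
proof -
  obtain t0 where t0: "0 < t0" and push:
    "\<And>z t. z \<in> \<Omega> \<Longrightarrow> bdist z \<le> t \<Longrightarrow> t \<le> t0 \<Longrightarrow>
       \<exists>z'. ball z' (t / 4) \<subseteq> \<Omega> \<and> dist z z' \<le> t \<and>
         kobayashi_dist \<Omega> z z' \<le> ln (8 * t / bdist z) / 2"
    using kobayashi_dist_push by blast
  show ?thesis
  proof (rule that[OF t0])
    fix z w t
    assume z: "z \<in> \<Omega>" "bdist z \<le> t" and w: "w \<in> \<Omega>" "bdist w \<le> t"
      and zw: "dist z w \<le> t" and t: "t \<le> t0"
    have pos: "0 < bdist z" "0 < bdist w" "0 < t" using bdist_pos z w by force+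
    obtain z' where z': "ball z' (t / 4) \<subseteq> \<Omega>" "dist z z' \<le> t"
      "kobayashi_dist \<Omega> z z' \<le> ln (8 * t / bdist z) / 2" using push[OF z t] by blast
    obtain w' where w': "ball w' (t / 4) \<subseteq> \<Omega>" "dist w w' \<le> t"
      "kobayashi_dist \<Omega> w w' \<le> ln (8 * t / bdist w) / 2" using push[OF w t] by blast
    have in_dom: "z' \<in> \<Omega>" "w' \<in> \<Omega>" using z'(1) w'(1) pos by auto
    have "dist w' z' \<le> dist w' w + (dist w z + dist z z')"
      by (meson add_left_mono dist_triangle order_trans)
    \<comment> \<open>The pushed points are at most 3 t apart, which is 24 steps of half the radius
      \<open>t / 4\<close>. This number does not depend on \<open>t\<close>, so joining them costs a
      constant.\<close>
    then have "norm (w' - z') \<le> real 24 * (t / 4) / 2"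
      using z'(2) w'(2) zw by (simp add: dist_commute dist_norm)
    then obtain S where S: "S \<le> real 24 * artanh (1 / 2)" "chain_length \<Omega> z' w' S"
      using chain_length_convex[OF convex_dom z'(1) w'(1), of 24] pos by auto
    have "kobayashi_dist \<Omega> z w \<le> kobayashi_dist \<Omega> z z' + kobayashi_dist \<Omega> z' w"
      by (rule kobayashi_dist_triangle'[OF z(1) in_dom(1) w(1)])
    also have "kobayashi_dist \<Omega> z' w \<le> kobayashi_dist \<Omega> z' w' + kobayashi_dist \<Omega> w' w"
      by (rule kobayashi_dist_triangle'[OF in_dom w(1)])
    also have "kobayashi_dist \<Omega> w' w = kobayashi_dist \<Omega> w w'" by (rule kobayashi_dist_commute)
    finally have "kobayashi_dist \<Omega> z w
        \<le> ln (8 * t / bdist z) / 2 + ln (8 * t / bdist w) / 2 + real 24 * artanh (1 / 2)"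
      using z'(3) w'(3) kobayashi_dist_le[OF S(2)] S(1) by linarith
    also have "\<dots> = ln (8 * t) - ln (bdist z) / 2 - ln (bdist w) / 2 + real 24 * artanh (1 / 2)"
      using pos by (simp add: ln_div diff_divide_distrib)
    finally show "kobayashi_dist \<Omega> z w
        \<le> ln (8 * t) - ln (bdist z) / 2 - ln (bdist w) / 2 + real 24 * artanh (1 / 2)" .
  qed
qed

lemma kobayashi_dist_le_ln_bdist:
  assumes o: "o' \<in> \<Omega>"
  obtains C where "\<And>z. z \<in> \<Omega> \<Longrightarrow> kobayashi_dist \<Omega> o' z \<le> - ln (bdist z) / 2 + C"
proof -
  obtain t0 where t0: "0 < t0" and push:
    "\<And>z t. z \<in> \<Omega> \<Longrightarrow> bdist z \<le> t \<Longrightarrow> t \<le> t0 \<Longrightarrow>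
       \<exists>z'. ball z' (t / 4) \<subseteq> \<Omega> \<and> dist z z' \<le> t \<and>
         kobayashi_dist \<Omega> z z' \<le> ln (8 * t / bdist z) / 2"
    using kobayashi_dist_push by blast
  define b where "b = min (t0 / 4) (bdist o')"
  have b: "0 < b" "b \<le> t0 / 4" "b \<le> bdist o'" using t0 bdist_pos[OF o] by (auto simp: b_def)
  have ob: "ball o' b \<subseteq> \<Omega>" using ball_bdist_subset[OF o] b(3) subset_ball by blast
  obtain M where M: "\<And>z w. ball z b \<subseteq> \<Omega> \<Longrightarrow> ball w b \<subseteq> \<Omega> \<Longrightarrow> kobayashi_dist \<Omega> z w \<le> M"
    using bounded_kobayashi_dist[OF b(1)] by blast
  \<comment> \<open>Bounds \<open>bdist\<close> above, so that a constant absorbs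
    \<open>- ln (bdist z) / 2\<close> for points deep in the domain.\<close>
  define D where "D = diameter (closure \<Omega>)"
  have le_D: "bdist z \<le> D" if "z \<in> \<Omega>" for z
  proof -
    obtain \<xi> where \<xi>: "\<xi> \<in> frontier \<Omega>" using frontier_nonempty by blast
    then have "bdist z \<le> dist z \<xi>" by (rule infdist_le)
    also have "\<dots> \<le> D" unfolding D_def
      using \<xi> that closure_subset bounded_dom
      by (intro diameter_bounded_bound) (auto simp: frontier_def)
    finally show ?thesis .
  qed
  show ?thesis
  proof (rule that[of "M + \<bar>ln D\<bar> / 2 + \<bar>ln (8 * t0)\<bar> / 2"])
    fix z assume z: "z \<in> \<Omega>"
    have d: "0 < bdist z" by (rule bdist_pos[OF z])
    show "kobayashi_dist \<Omega> o' z
        \<le> - ln (bdist z) / 2 + (M + \<bar>ln D\<bar> / 2 + \<bar>ln (8 * t0)\<bar> / 2)"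
    proof (cases "bdist z \<le> t0")
      case True
      then obtain z' where z': "ball z' (t0 / 4) \<subseteq> \<Omega>"
        "kobayashi_dist \<Omega> z z' \<le> ln (8 * t0 / bdist z) / 2" using push[OF z] by blast
      have "z' \<in> \<Omega>" using z'(1) t0 by auto
      then have "kobayashi_dist \<Omega> o' z \<le> kobayashi_dist \<Omega> o' z' + kobayashi_dist \<Omega> z' z"
        by (rule kobayashi_dist_triangle'[OF o _ z])
      also have "kobayashi_dist \<Omega> z' z = kobayashi_dist \<Omega> z z'" by (rule kobayashi_dist_commute)
      also have "kobayashi_dist \<Omega> o' z' \<le> M"
        using z'(1) b(2) subset_ball by (intro M ob) blast
      finally have "kobayashi_dist \<Omega> o' z \<le> M + ln (8 * t0 / bdist z) / 2" using z'(2) by simp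
      also have "\<dots> = M + ln (8 * t0) / 2 - ln (bdist z) / 2"
        using t0 d by (simp add: ln_div diff_divide_distrib)
      finally show ?thesis by (simp add: abs_if)
    next
      case False
      then have "ball z b \<subseteq> \<Omega>"
        using ball_bdist_subset[OF z] b(2) t0 subset_ball[of b "bdist z" z] by force
      then have "kobayashi_dist \<Omega> o' z \<le> M" by (rule M[OF ob])
      moreover have "ln (bdist z) \<le> ln D" using d le_D[OF z] by (intro ln_mono)
      ultimately show ?thesis by (simp add: abs_if)
    qed
  qed
qed

end

lemma artanh_real_le_double:
  assumes "0 \<le> x" "x \<le> (1 / 2 :: real)"
  shows "artanh x \<le> 2 * x"
proof -
  have "x * (4 * x) \<le> x * 2" using assms by (intro mult_left_mono) auto
  then have "(1 + x) / (1 - x) \<le> 1 + 4 * x" using assms by (simp add: field_simps)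
  then have "ln ((1 + x) / (1 - x)) \<le> ln (1 + 4 * x)" using assms by (intro ln_mono) auto
  also have "\<dots> \<le> 4 * x" using assms by (intro ln_add_one_self_le_self) auto
  finally show ?thesis by (simp add: artanh_def)
qed

subsection \<open>Extension of isometric embeddings\<close>

theorem theorem1p3:
  fixes \<Omega>\<^sub>1 U\<^sub>1 :: "(complex ^ 'n1) set" and \<rho>\<^sub>1 :: "complex ^ 'n1 \<Rightarrow> real"
    and \<Omega>\<^sub>2 U\<^sub>2 :: "(complex ^ 'n2) set" and \<rho>\<^sub>2 :: "complex ^ 'n2 \<Rightarrow> real"
    and r :: real and \<omega> :: "real \<Rightarrow> real"
    and F :: "complex ^ 'n1 \<Rightarrow> complex ^ 'n2"
  assumes "open \<Omega>\<^sub>1" and "\<Omega>\<^sub>1 \<noteq> {}" and "bounded \<Omega>\<^sub>1" and "convex \<Omega>\<^sub>1" and "C1_boundary \<Omega>\<^sub>1"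
    and "open \<Omega>\<^sub>2" and "\<Omega>\<^sub>2 \<noteq> {}" and "bounded \<Omega>\<^sub>2" and "convex \<Omega>\<^sub>2" and "C1_boundary \<Omega>\<^sub>2"
    and "r > 0"
    and "defining_function \<Omega>\<^sub>1 U\<^sub>1 \<rho>\<^sub>1" and "\<And>\<xi>. \<xi> \<in> frontier \<Omega>\<^sub>1 \<Longrightarrow> ball \<xi> r \<subseteq> U\<^sub>1"
    and "defining_function \<Omega>\<^sub>2 U\<^sub>2 \<rho>\<^sub>2" and "\<And>\<xi>. \<xi> \<in> frontier \<Omega>\<^sub>2 \<Longrightarrow> ball \<xi> r \<subseteq> U\<^sub>2"
    and "\<And>\<xi>. \<xi> \<in> frontier \<Omega>\<^sub>1 \<Longrightarrow>
           has_modulus_of_continuity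
             (directional_derivative (\<i> *s inward_unit_normal \<Omega>\<^sub>1 \<xi>) \<rho>\<^sub>1) \<xi> r \<omega>"
    and "\<And>\<xi>. \<xi> \<in> frontier \<Omega>\<^sub>2 \<Longrightarrow>
           has_modulus_of_continuity
             (directional_derivative (\<i> *s inward_unit_normal \<Omega>\<^sub>2 \<xi>) \<rho>\<^sub>2) \<xi> r \<omega>"
    and "dini_condition (2 * r) \<omega>"
    and "C_strictly_convex \<Omega>\<^sub>2"
    and "kobayashi_isometric_embedding F \<Omega>\<^sub>1 \<Omega>\<^sub>2"
  shows "\<exists>F'. continuous_on (closure \<Omega>\<^sub>1) F' \<and> F' ` closure \<Omega>\<^sub>1 \<subseteq> closure \<Omega>\<^sub>2 \<and>
              (\<forall>z\<in>\<Omega>\<^sub>1. F' z = F z)"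
proof -
  interpret D1: Dini_convex_domain \<Omega>\<^sub>1 U\<^sub>1 \<rho>\<^sub>1 r \<omega> by unfold_locales (fact assms)+
  interpret D2: Dini_convex_domain \<Omega>\<^sub>2 U\<^sub>2 \<rho>\<^sub>2 r \<omega> by unfold_locales (fact assms)+
  have F_in: "\<And>z. z \<in> \<Omega>\<^sub>1 \<Longrightarrow> F z \<in> \<Omega>\<^sub>2"
    and iso: "\<And>z w. z \<in> \<Omega>\<^sub>1 \<Longrightarrow> w \<in> \<Omega>\<^sub>1 \<Longrightarrow>
      kobayashi_dist \<Omega>\<^sub>2 (F z) (F w) = kobayashi_dist \<Omega>\<^sub>1 z w"
    using assms(20) by (auto simp: kobayashi_isometric_embedding_def)
  obtain o' where o: "o' \<in> \<Omega>\<^sub>1" using assms(2) by blast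
  obtain A1 where A1: "\<And>z. z \<in> \<Omega>\<^sub>1 \<Longrightarrow> - ln (D1.bdist z) / 2 - A1 \<le> kobayashi_dist \<Omega>\<^sub>1 o' z"
    using D1.kobayashi_dist_ge_ln_bdist[OF o] by blast
  obtain A2 where A2: "\<And>z. z \<in> \<Omega>\<^sub>2 \<Longrightarrow> kobayashi_dist \<Omega>\<^sub>2 (F o') z \<le> - ln (D2.bdist z) / 2 + A2"
    using D2.kobayashi_dist_le_ln_bdist[OF F_in[OF o]] by blast
  obtain t0 A4 where t0: "0 < t0" and A4: "\<And>z w t. z \<in> \<Omega>\<^sub>1 \<Longrightarrow> w \<in> \<Omega>\<^sub>1 \<Longrightarrow>
       D1.bdist z \<le> t \<Longrightarrow> D1.bdist w \<le> t \<Longrightarrow> dist z w \<le> t \<Longrightarrow> t \<le> t0 \<Longrightarrow>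
       kobayashi_dist \<Omega>\<^sub>1 z w \<le> ln (8 * t) - ln (D1.bdist z) / 2 - ln (D1.bdist w) / 2 + A4"
    using D1.kobayashi_dist_near_boundary_le by blast
  obtain c where c: "0 < c" and le_chain:
    "\<And>z w S. chain_length \<Omega>\<^sub>2 z w S \<Longrightarrow> norm (z - w) \<le> c * S"
    using bounded_chain_length_ge_norm[OF assms(8)] by blast
  have le_kob: "dist z w \<le> c * kobayashi_dist \<Omega>\<^sub>2 z w" if zw: "z \<in> \<Omega>\<^sub>2" "w \<in> \<Omega>\<^sub>2" for z w
  proof -
    obtain T where T: "chain_length \<Omega>\<^sub>2 z w T" by (rule D2.chain_exists[OF zw])
    have "norm (z - w) / c \<le> kobayashi_dist \<Omega>\<^sub>2 z w"
      by (rule le_kobayashi_dist[OF T]) (use le_chain c in \<open>simp add: divide_le_eq mult.commute\<close>)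
    then show ?thesis using c by (simp add: divide_le_eq mult.commute dist_norm)
  qed
  have uc: "uniformly_continuous_on \<Omega>\<^sub>1 F"
    unfolding uniformly_continuous_on_def
  proof (intro allI impI)
    fix s :: real assume s: "0 < s"
    obtain e A3 where e: "0 < e" and A3:
      "\<And>z w. z \<in> \<Omega>\<^sub>2 \<Longrightarrow> w \<in> \<Omega>\<^sub>2 \<Longrightarrow> s \<le> dist z w \<Longrightarrow> D2.bdist z < e \<Longrightarrow> D2.bdist w < e \<Longrightarrow>
         - ln (D2.bdist z) / 2 - ln (D2.bdist w) / 2 - A3 \<le> kobayashi_dist \<Omega>\<^sub>2 z w"
      using D2.kobayashi_dist_two_point[OF assms(19) s] by blast
    \<comment> \<open>The first exponential brings images of points at depth at most
      \<open>t\<close> within \<open>e\<close> of the boundary; the second makes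
      \<open>ln (8 * t)\<close> too small for the final comparison. The summands -1 give strict
      inequalities.\<close>
    define t where "t = min t0 (min (exp (ln e - 2 * A1 - 2 * A2 - 1))
      (exp (- 2 * A1 - 2 * A2 - A3 - A4 - 1) / 8))"
    have t: "0 < t" "t \<le> t0" using t0 by (auto simp: t_def)
    have "ln t \<le> ln (exp (ln e - 2 * A1 - 2 * A2 - 1))" using t(1) by (intro ln_mono) (auto simp: t_def)
    then have t1: "ln t < ln e - 2 * A1 - 2 * A2" by simp
    have "ln (8 * t) \<le> ln (exp (- 2 * A1 - 2 * A2 - A3 - A4 - 1))"
      using t(1) by (intro ln_mono) (auto simp: t_def)
    then have t2: "ln (8 * t) < - 2 * A1 - 2 * A2 - A3 - A4" by simp
    \<comment> \<open>\<open>t / 4\<close> keeps \<open>w\<close> at depth at most \<open>t\<close>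
      when \<open>z\<close> has depth at most \<open>t / 2\<close>, and within half the radius of
      the ball about \<open>z\<close> otherwise; in that case the second bound makes the Kobayashi
      distance less than \<open>s / c\<close>.\<close>
    define d where "d = min (t / 4) (s * t / (4 * c))"
    have d: "0 < d" using t s c by (simp add: d_def)
    have image_near: "D2.bdist (F z) < e" if z: "z \<in> \<Omega>\<^sub>1" "D1.bdist z \<le> t" for z
    proof -
      have "- ln (D1.bdist z) / 2 - A1 \<le> - ln (D2.bdist (F z)) / 2 + A2"
        using A1[OF z(1)] A2[OF F_in[OF z(1)]] iso[OF o z(1)] by simp
      moreover have "ln (D1.bdist z) \<le> ln t" using z D1.bdist_pos by (intro ln_mono) auto
      ultimately have "ln (D2.bdist (F z)) < ln e" using t1 by simp
      then show ?thesis using e D2.bdist_pos[OF F_in[OF z(1)]] by simp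
    qed
    have "dist (F w) (F z) < s" if z: "z \<in> \<Omega>\<^sub>1" and w: "w \<in> \<Omega>\<^sub>1" and zw: "dist w z < d" for z w
    proof (cases "D1.bdist z \<le> t / 2")
      case True
      have "D1.bdist w \<le> D1.bdist z + dist w z"
        using infdist_triangle by blast
      moreover have "dist w z < t / 4" using zw by (simp add: d_def)
      ultimately have near: "D1.bdist z \<le> t" "D1.bdist w \<le> t" "dist z w \<le> t"
        using True t by (auto simp: dist_commute)
      show ?thesis
      proof (rule ccontr)
        assume "\<not> dist (F w) (F z) < s"
        then have "s \<le> dist (F z) (F w)" by (simp add: dist_commute)
        then have "- ln (D2.bdist (F z)) / 2 - ln (D2.bdist (F w)) / 2 - A3 \<le> kobayashi_dist \<Omega>\<^sub>1 z w"
          using A3[OF F_in[OF z] F_in[OF w]] image_near z w near iso[OF z w] by simp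
        moreover have "kobayashi_dist \<Omega>\<^sub>1 z w
            \<le> ln (8 * t) - ln (D1.bdist z) / 2 - ln (D1.bdist w) / 2 + A4"
          by (rule A4[OF z w near t(2)])
        moreover have "- ln (D1.bdist z) / 2 - A1 \<le> - ln (D2.bdist (F z)) / 2 + A2"
          using A1[OF z] A2[OF F_in[OF z]] iso[OF o z] by simp
        moreover have "- ln (D1.bdist w) / 2 - A1 \<le> - ln (D2.bdist (F w)) / 2 + A2"
          using A1[OF w] A2[OF F_in[OF w]] iso[OF o w] by simp
        \<comment> \<open>Replacing the image depths by those of \<open>z\<close> and
          \<open>w\<close> cancels all logarithms except \<open>ln (8 * t)\<close>, which would be
          at least \<open>- 2 * A1 - 2 * A2 - A3 - A4\<close>.\<close>
        ultimately show False using t2 by linarith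
      qed
    next
      case False
      have ball: "ball z (t / 2) \<subseteq> \<Omega>\<^sub>1"
        using D1.ball_bdist_subset[OF z] False subset_ball[of "t / 2" "D1.bdist z" z] by force
      have n: "norm (w - z) \<le> t / 4" using zw by (simp add: d_def dist_norm)
      then have "chain_length \<Omega>\<^sub>1 z w (artanh (norm (w - z) / (t / 2)))"
        using t by (intro chain_length_in_ball ball) simp
      then have "kobayashi_dist \<Omega>\<^sub>1 z w \<le> artanh (norm (w - z) / (t / 2))"
        by (rule kobayashi_dist_le)
      also have "\<dots> \<le> 2 * (norm (w - z) / (t / 2))"
        using n t by (intro artanh_real_le_double) (auto simp: field_simps)
      also have "\<dots> < 2 * (d / (t / 2))"
        using zw t by (intro mult_strict_left_mono divide_strict_right_mono) (auto simp: dist_norm)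
      also have "\<dots> \<le> 2 * (s * t / (4 * c) / (t / 2))"
        using t by (intro mult_left_mono divide_right_mono) (auto simp: d_def)
      also have "\<dots> = s / c" using t c by (simp add: field_simps)
      finally have "c * kobayashi_dist \<Omega>\<^sub>1 z w < s" using c by (simp add: field_simps)
      then show ?thesis
        using le_kob[OF F_in[OF z] F_in[OF w]] iso[OF z w] by (simp add: dist_commute)
    qed
    then show "\<exists>d>0. \<forall>z\<in>\<Omega>\<^sub>1. \<forall>w\<in>\<Omega>\<^sub>1. dist w z < d \<longrightarrow> dist (F w) (F z) < s"
      using d by blast
  qed
  obtain F' where F': "uniformly_continuous_on (closure \<Omega>\<^sub>1) F'" "\<And>z. z \<in> \<Omega>\<^sub>1 \<Longrightarrow> F z = F' z"
    by (rule uniformly_continuous_on_extension_on_closure[OF uc]) (rule that, assumption, simp)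
  then have cont: "continuous_on (closure \<Omega>\<^sub>1) F'"
    by (intro uniformly_continuous_imp_continuous)
  moreover have "F' ` closure \<Omega>\<^sub>1 \<subseteq> closure \<Omega>\<^sub>2"
  proof (rule image_closure_subset[OF cont closed_closure])
    show "F' ` \<Omega>\<^sub>1 \<subseteq> closure \<Omega>\<^sub>2"
      using F'(2) F_in closure_subset[of \<Omega>\<^sub>2] by force
  qed
  moreover have "\<forall>z\<in>\<Omega>\<^sub>1. F' z = F z" using F'(2) by simp
  ultimately show ?thesis by blast
qed

end
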